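(* Let $\mathbf{a}\in\mathcal{A}^\sharp$. Then the $\Sigma_T$-equivalence class of $\mathbf{a}$ is partitioned in at most $d$ tail-equivalence classes, where $d$ is the defect of $T$.
   Context: $T$ is a slow continued fraction algorithm on $[0,\infty]$ with inverse branches $A_0,\dots,A_{n-1}\in\mathrm{PGL}_2\mathbb{Z}$ (nonnegative entries, $A_a*[0,\infty]=\Delta_a$ forming a unimodular partition, $T=A_a^{-1}$ on $\Delta_a$), $\Sigma_T=\langle A_0,\dots,A_{n-1}\rangle$, $\mathcal{A}=\{0,\dots,n-1\}$. $\sigma$ maps a $T$-symbolic orbit $\mathbf{a}$ ($T^t(\alpha)\in\Delta_{a_t}$ for all $t$) to $\alpha$; $\mathcal{A}^\sharp\subseteq\mathcal{A}^\omega$ is the set of $T$-symbolic orbits of irrationals $\alpha>0$. Two elements $\mathbf{a},\mathbf{b}$ are tail-equivalent if $a_{h+l}=b_{k+l}$ for some $h,k$ and all $l\ge0$, and $\Sigma_T$-equivalent if $\sigma(\mathbf{a}),\sigma(\mathbf{b})$ are in the same $\Sigma_T$-orbit under the projective action. Defect: let $\mathcal{G}_T$ be the graph of $T$ (two copies of the finite binary tree of left factors, in the free monoid on $L=\begin{bmatrix}1&0\\1&1\end{bmatrix}$, $N=\begin{bmatrix}1&1\\0&1\end{bmatrix}$, of the matrices $B_a$ where $A_a=B_aF^{e(a)}$, $F=\begin{bmatrix}0&1\\1&0\end{bmatrix}$, joined by $F$-edges, with leaves $B_a,B_aF$ glued to the root $1$ and its $F$-twin $2$ according to $e(a)$), and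 let $\varphi$ be the opfibration from $\mathcal{G}_T$ onto the Schreier graph of $\Sigma_T$ in $\mathrm{PGL}_2\mathbb{Z}$ w.r.t. $\{L,N,F\}$. A primitive path is a path in $\mathcal{G}_T$ from $i\in\{1,2\}$ to $j\in\{1,2\}$ with no intermediate visits to $1$ or $2$; each $A_a$ corresponds to exactly two primitive paths (an $F$-twin pair) whose $L,N$ word $W$ satisfies $\pi({}_iW_j)=A_a$. Let $D_a$ be the set of vertices on these two paths. The defect $d$ is $\max_a |D_a\cap\varphi^{-1}\{1\}|$. *)

theory Defs
  imports
    "HOL-Analysis.Analysis"
    "HOL-Algebra.Generated_Groups"
    "HOL-Library.Sublist"
    "Graph_Theory.Graph_Theory"
begin

section \<open>The group and its projective action\<close>

definition GL2Z :: "(int^2^2) monoid" where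
  "GL2Z = \<lparr>carrier = {M. \<bar>det M\<bar> = 1}, mult = (**), one = mat 1\<rparr>"

definition PGL2Z :: "(int^2^2) set monoid" where
  "PGL2Z = GL2Z Mod {mat 1, - mat 1}"

text \<open>The class \<open>{M, - M}\<close> of a matrix.\<close>

definition pgl :: "int^2^2 \<Rightarrow> (int^2^2) set" where
  "pgl M = {mat 1, - mat 1} #>\<^bsub>GL2Z\<^esub> M"

text \<open>
  A point of the real projective line is represented by a real number or by \<open>\<infinity>\<close>. The value at
  \<open>-\<infinity>\<close> is the one at \<open>\<infinity>\<close> and plays no role.
\<close>

definition moebius :: "int^2^2 \<Rightarrow> ereal \<Rightarrow> ereal" where
  "moebius M x =
    (let a = real_of_int (M$1$1); b = real_of_int (M$1$2);
         c = real_of_int (M$2$1); d = real_of_int (M$2$2)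
     in case x of
          ereal r \<Rightarrow> if c * r + d = 0 then \<infinity> else ereal ((a * r + b) / (c * r + d))
        | _ \<Rightarrow> if c = 0 then \<infinity> else ereal (a / c))"

text \<open>\<open>M\<close> and \<open>- M\<close> induce the same map, so the image below is a singleton.\<close>

definition pgl_act :: "(int^2^2) set \<Rightarrow> ereal \<Rightarrow> ereal" where
  "pgl_act X x = the_elem ((\<lambda>M. moebius M x) ` X)"


section \<open>Slow continued fraction algorithms\<close>

definition frac_point :: "nat \<Rightarrow> nat \<Rightarrow> ereal" where
  "frac_point p q = (if q = 0 then \<infinity> else ereal (real p / real q))"

text \<open>
  The endpoints \<open>p/q < p'/q'\<close> are in \<open>[0,\<infinity>]\<close>, with \<open>1/0 = \<infinity>\<close>.
\<close>

definition unimodular_interval :: "ereal set \<Rightarrow> bool" where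
  "unimodular_interval I \<longleftrightarrow>
    (\<exists>p q p' q'. int p' * int q - int p * int q' = 1 \<and> I = {frac_point p q .. frac_point p' q'})"

definition unimodular_partition :: "nat \<Rightarrow> (nat \<Rightarrow> ereal set) \<Rightarrow> bool" where
  "unimodular_partition n D \<longleftrightarrow>
    (\<forall>a<n. unimodular_interval (D a)) \<and> (\<Union>a<n. D a) = {0..\<infinity>} \<and>
    (\<forall>a<n. \<forall>b<n. a \<noteq> b \<longrightarrow> interior (D a) \<inter> interior (D b) = {})"

text \<open>
  The branches are given by their representatives in \<open>GL2Z\<close> with nonnegative entries, which are
  unique.
\<close>

definition branch_interval :: "int^2^2 \<Rightarrow> ereal set" where
  "branch_interval M = pgl_act (pgl M) ` {0..\<infinity>}"

definition slow_cf :: "nat \<Rightarrow> (nat \<Rightarrow> int^2^2) \<Rightarrow> bool" where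
  "slow_cf n A \<longleftrightarrow> 2 \<le> n \<and>
    (\<forall>a<n. A a \<in> carrier GL2Z \<and> (\<forall>i j. 0 \<le> A a $ i $ j)) \<and>
    unimodular_partition n (\<lambda>a. branch_interval (A a))"

definition Sigma_T :: "nat \<Rightarrow> (nat \<Rightarrow> int^2^2) \<Rightarrow> (int^2^2) set set" where
  "Sigma_T n A = generate PGL2Z ((\<lambda>a. pgl (A a)) ` {..<n})"

text \<open>
  At a common endpoint of two intervals the map \<open>T\<close> has more than one branch; a symbolic orbit
  then records the branch that is applied. Here \<open>x t\<close> is the \<open>t\<close>-th iterate of \<open>\<alpha>\<close>.
  Irrational points never meet an endpoint.
\<close>

definition symbolic_orbit :: "nat \<Rightarrow> (nat \<Rightarrow> int^2^2) \<Rightarrow> (nat \<Rightarrow> nat) \<Rightarrow> ereal \<Rightarrow> bool" where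
  "symbolic_orbit n A a \<alpha> \<longleftrightarrow>
    (\<exists>x. x 0 = \<alpha> \<and>
      (\<forall>t. a t < n \<and> x t \<in> branch_interval (A (a t)) \<and>
           x (Suc t) = pgl_act (inv\<^bsub>PGL2Z\<^esub> (pgl (A (a t)))) (x t)))"

definition sigma :: "nat \<Rightarrow> (nat \<Rightarrow> int^2^2) \<Rightarrow> (nat \<Rightarrow> nat) \<Rightarrow> ereal" where
  "sigma n A a = (THE \<alpha>. symbolic_orbit n A a \<alpha>)"

definition A_sharp :: "nat \<Rightarrow> (nat \<Rightarrow> int^2^2) \<Rightarrow> (nat \<Rightarrow> nat) set" where
  "A_sharp n A = {a. \<exists>r::real. 0 < r \<and> r \<notin> \<rat> \<and> symbolic_orbit n A a (ereal r)}"

definition tail_equiv :: "nat \<Rightarrow> (nat \<Rightarrow> int^2^2) \<Rightarrow> ((nat \<Rightarrow> nat) \<times> (nat \<Rightarrow> nat)) set" where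
  "tail_equiv n A =
    {(a, b). a \<in> A_sharp n A \<and> b \<in> A_sharp n A \<and> (\<exists>h k. \<forall>l. a (h + l) = b (k + l))}"

definition Sigma_equiv :: "nat \<Rightarrow> (nat \<Rightarrow> int^2^2) \<Rightarrow> ((nat \<Rightarrow> nat) \<times> (nat \<Rightarrow> nat)) set" where
  "Sigma_equiv n A =
    {(a, b). a \<in> A_sharp n A \<and> b \<in> A_sharp n A \<and>
             (\<exists>S\<in>Sigma_T n A. pgl_act S (sigma n A a) = sigma n A b)}"


section \<open>The graph of the algorithm\<close>

datatype gen = L | N | F

fun gmat :: "gen \<Rightarrow> int^2^2" where
  "gmat L = vector [vector [1, 0], vector [1, 1]]"
| "gmat N = vector [vector [1, 1], vector [0, 1]]"
| "gmat F = vector [vector [0, 1], vector [1, 0]]"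

definition wmat :: "gen list \<Rightarrow> int^2^2" where
  "wmat w = foldr (\<lambda>g M. gmat g ** M) w (mat 1)"

definition Fpow :: "bool \<Rightarrow> int^2^2" where
  "Fpow e = (if e then gmat F else mat 1)"

text \<open>
  The factorization \<open>A\<^sub>a = B\<^sub>a F\<^bsup>e(a)\<^esup>\<close>. Words over \<open>{L, N}\<close> stand for the elements of the monoid
  generated by \<open>L\<close> and \<open>N\<close>, which is free; a matrix in \<open>GL2Z\<close> with nonnegative entries has exactly
  one such factorization.
\<close>

definition LN_factor :: "int^2^2 \<Rightarrow> gen list \<times> bool" where
  "LN_factor M = (THE (w, e). set w \<subseteq> {L, N} \<and> M = wmat w ** Fpow e)"

abbreviation B_word :: "int^2^2 \<Rightarrow> gen list" where
  "B_word M \<equiv> fst (LN_factor M)"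

abbreviation e_exp :: "int^2^2 \<Rightarrow> bool" where
  "e_exp M \<equiv> snd (LN_factor M)"

text \<open>
  The pair \<open>(w, c)\<close> stands for the matrix \<open>w F\<^sup>c\<close>: the flag \<open>c\<close> tells in which of the two copies of
  the tree the vertex lies. Its equivalence class in the graph is represented by \<open>glue (w, c)\<close>. A
  leaf \<open>(B\<^sub>a, c)\<close> is glued to \<open>1\<close> if \<open>c = e(a)\<close> and to \<open>2\<close> otherwise, because
  \<open>B\<^sub>a F\<^sup>c = A\<^sub>a F\<^bsup>e(a)+c\<^esup>\<close>.
\<close>

type_synonym vertex = "gen list \<times> bool"

definition vertex1 :: vertex where "vertex1 = ([], False)"
definition vertex2 :: vertex where "vertex2 = ([], True)"

definition left_factors :: "nat \<Rightarrow> (nat \<Rightarrow> int^2^2) \<Rightarrow> gen list set" where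
  "left_factors n A = {w. \<exists>a<n. prefix w (B_word (A a))}"

definition glue :: "nat \<Rightarrow> (nat \<Rightarrow> int^2^2) \<Rightarrow> vertex \<Rightarrow> vertex" where
  "glue n A v = (case v of (w, c) \<Rightarrow>
    if \<exists>a<n. w = B_word (A a)
    then (if c = e_exp (A (THE a. a < n \<and> w = B_word (A a))) then vertex1 else vertex2)
    else (w, c))"

text \<open>In the second copy the labels are exchanged, since \<open>F L = N F\<close> and \<open>F N = L F\<close>.\<close>

fun twin_label :: "gen \<Rightarrow> gen" where
  "twin_label L = N"
| "twin_label N = L"
| "twin_label F = F"

definition tree_edges :: "nat \<Rightarrow> (nat \<Rightarrow> int^2^2) \<Rightarrow> (vertex \<times> gen \<times> vertex) set" where
  "tree_edges n A =
    {((w, c), if c then twin_label g else g, (w @ [g], c)) | w c g.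
       g \<in> {L, N} \<and> w @ [g] \<in> left_factors n A} \<union>
    {((w, c), F, (w, \<not> c)) | w c. w \<in> left_factors n A}"

type_synonym 'v lgraph = "('v, 'v \<times> gen \<times> 'v) pre_digraph"

definition lgraph :: "'v set \<Rightarrow> ('v \<times> gen \<times> 'v) set \<Rightarrow> 'v lgraph" where
  "lgraph V E = \<lparr>verts = V, arcs = E, tail = (\<lambda>(u, g, v). u), head = (\<lambda>(u, g, v). v)\<rparr>"

definition arc_label :: "'v \<times> gen \<times> 'v \<Rightarrow> gen" where
  "arc_label = (\<lambda>(u, g, v). g)"

definition graph_T :: "nat \<Rightarrow> (nat \<Rightarrow> int^2^2) \<Rightarrow> vertex lgraph" where
  "graph_T n A = lgraph
    (glue n A ` (left_factors n A \<times> UNIV))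
    ((\<lambda>(u, g, v). (glue n A u, g, glue n A v)) ` tree_edges n A)"

definition schreier_graph :: "(int^2^2) set set \<Rightarrow> (int^2^2) set set lgraph" where
  "schreier_graph H = lgraph
    (rcosets\<^bsub>PGL2Z\<^esub> H)
    {(X, g, X #>\<^bsub>PGL2Z\<^esub> pgl (gmat g)) | X g. X \<in> rcosets\<^bsub>PGL2Z\<^esub> H}"

text \<open>
  The opfibration of \<^term>\<open>graph_T n A\<close> onto \<^term>\<open>schreier_graph (Sigma_T n A)\<close>: a vertex goes to
  the right coset of the matrix it stands for. The vertex \<open>1\<close> of the Schreier graph is the coset
  \<^term>\<open>Sigma_T n A\<close>.
\<close>

definition phi :: "nat \<Rightarrow> (nat \<Rightarrow> int^2^2) \<Rightarrow> vertex \<Rightarrow> (int^2^2) set set" where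
  "phi n A v = Sigma_T n A #>\<^bsub>PGL2Z\<^esub> pgl (wmat (fst v) ** Fpow (snd v))"


section \<open>Primitive paths and the defect\<close>

text \<open>Paths follow the edges labelled \<open>L\<close> or \<open>N\<close> only, so that they spell words in \<open>{L, N}\<close>.\<close>

definition primitive_path ::
    "nat \<Rightarrow> (nat \<Rightarrow> int^2^2) \<Rightarrow> vertex \<Rightarrow> (vertex \<times> gen \<times> vertex) list \<Rightarrow> vertex \<Rightarrow> bool" where
  "primitive_path n A i p j \<longleftrightarrow>
    i \<in> {vertex1, vertex2} \<and> j \<in> {vertex1, vertex2} \<and> p \<noteq> [] \<and>
    pre_digraph.awalk (graph_T n A) i p j \<and> arc_label ` set p \<subseteq> {L, N} \<and>
    set (tl (butlast (pre_digraph.awalk_verts (graph_T n A) i p))) \<inter> {vertex1, vertex2} = {}"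

text \<open>The class of \<open>F\<^bsup>i-1\<^esup> W F\<^bsup>j-1\<^esup>\<close>, where \<open>W\<close> is the word spelled by the path.\<close>

definition path_value :: "vertex \<Rightarrow> (vertex \<times> gen \<times> vertex) list \<Rightarrow> vertex \<Rightarrow> (int^2^2) set" where
  "path_value i p j =
    pgl (Fpow (i = vertex2) ** wmat (map arc_label p) ** Fpow (j = vertex2))"

definition D_set :: "nat \<Rightarrow> (nat \<Rightarrow> int^2^2) \<Rightarrow> nat \<Rightarrow> vertex set" where
  "D_set n A a =
    \<Union> {set (pre_digraph.awalk_verts (graph_T n A) i p) | i p j.
         primitive_path n A i p j \<and> path_value i p j = pgl (A a)}"

definition defect :: "nat \<Rightarrow> (nat \<Rightarrow> int^2^2) \<Rightarrow> nat" where
  "defect n A = Max ((\<lambda>a. card {v \<in> D_set n A a. phi n A v = Sigma_T n A}) ` {..<n})"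

end

(*
  Every irrational r > 0 has a unique expansion as an infinite word in L, N, and a symbolic orbit of r
  is a factorization of that word, up to exchanging L and N, into the words B_a. Let b be
  Sigma_T-equivalent to the orbit of r, say sigma(b) = S r. The matrix S maps long prefixes of the word
  of r to prefixes of the word of S r, so the path of b in the graph can be read along the word of r;
  say that b visits the root at time s if S times the prefix of length s is a product of branches up to
  F. Two sequences that visit the root at the same time with the same twist have a common tail.

  Given pairwise inequivalent b_1, ..., b_m, look at the last visit of each one before some late time,
  and let b_i be the one whose last visit is earliest. The last visits of all the others then fall
  within the primitive path that b_i is following, for a branch A_a say. There b_i sits at a vertex of
  D_a (possibly replaced by its F-twin) that stands for a matrix in Sigma_T, and distinct b_j give
  distinct vertices. Hence m is at most the defect.
*)
theory Submission
  imports Defs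
begin

section \<open>The group and its action on irrational numbers\<close>

text \<open>The infinite word of \<open>r\<close> is handled through its prefixes only, and
  comparisons of sequences become equalities of irrational points, since a point determines its
  letters, its branch and its orbit. Two facts need an estimate: a matrix \<open>S\<close> turns
  long prefixes into matrices that are nonnegative up to sign, and a symbol sequence has a single
  point among all extended reals, as the definite description \<open>sigma\<close> demands. Both
  rest on the growth of the denominators of words in L, N. The image of a prefix under
  \<open>S\<close> is in general not a product of branches, so the prefix has to be prolonged to the
  end of a branch before a visit is found. The earliest last visit is singled out because the next
  visit of that sequence comes after the chosen time, so its current branch word covers all the last
  visits. Reading one prefix through the matrices of two sequences puts the resulting vertex over
  the coset \<open>Sigma_T\<close>.\<close>

lemma (in group) subgroup_transfer:
  assumes "subgroup H G" "s \<in> H" "s' \<in> H" "m \<in> H" "m' \<in> H"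
    and G: "p \<in> carrier G" "u \<in> carrier G" "f \<in> carrier G" "f' \<in> carrier G"
    and eq: "s \<otimes> p = m \<otimes> (u \<otimes> f)" "s' \<otimes> p = m' \<otimes> f'" and "f' \<otimes> f' = \<one>"
  shows "u \<otimes> (f \<otimes> f') \<in> H"
proof -
  interpret H: subgroup H G by fact
  note H = assms(2-5)
  note H' = H[THEN H.mem_carrier]
  \<comment> \<open>Substituting for \<open>p\<close> from the second equation leaves
    \<open>u f f'\<close> as a product of elements of \<open>H\<close>. Here \<open>p\<close> stands
    for a prefix read through \<open>s\<close> and \<open>s'\<close>, where \<open>m\<close>,
    \<open>m'\<close> are the branches completed and \<open>u\<close> is the part read of an
    unfinished branch.\<close>
  have "u \<otimes> f = inv m \<otimes> (s \<otimes> p)" "p = inv s' \<otimes> (m' \<otimes> f')"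
    using H' G by (simp add: eq(1) inv_solve_left, simp add: eq(2)[symmetric] inv_solve_left)
  then have "u \<otimes> f \<otimes> f' = inv m \<otimes> (s \<otimes> (inv s' \<otimes> (m' \<otimes> f'))) \<otimes> f'"
    by simp
  also have "\<dots> = inv m \<otimes> s \<otimes> inv s' \<otimes> m' \<otimes> (f' \<otimes> f')"
    using H' G by (simp add: m_assoc)
  also have "\<dots> \<in> H"
    using H H' by (simp add: assms)
  finally show ?thesis
    using G by (simp add: m_assoc)
qed

section \<open>Integer matrices modulo sign\<close>

lemmas mat2_simps = matrix_matrix_mult_def sum_2 vec_eq_iff forall_2 det_2 mat_def

lemma carrier_GL2Z [simp]: "M \<in> carrier GL2Z \<longleftrightarrow> \<bar>det M\<bar> = 1"
  by (simp add: GL2Z_def)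

lemma mult_GL2Z [simp]: "M \<otimes>\<^bsub>GL2Z\<^esub> M' = M ** M'"
  by (simp add: GL2Z_def)

lemma one_GL2Z [simp]: "\<one>\<^bsub>GL2Z\<^esub> = mat 1"
  by (simp add: GL2Z_def)

lemma GL2Z_left_inverse:
  fixes M :: "int^2^2"
  assumes "\<bar>det M\<bar> = 1"
  obtains M' where "\<bar>det M'\<bar> = 1" "M' ** M = mat 1"
proof -
  \<comment> \<open>The adjugate divided by the determinant; the determinant is a sign, so dividing
    by it is multiplying by it.\<close>
  define M' :: "int^2^2" where "M' = vector [vector [det M * M$2$2, - det M * M$1$2],
    vector [- det M * M$2$1, det M * M$1$1]]"
  have sq: "det M * det M = 1"
    using assms by (metis abs_mult_self_eq mult_1)
  have "det M' = det M * det M * det M"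
    by (simp add: M'_def det_2 algebra_simps)
  moreover have "M' ** M = mat (det M * det M)"
    by (simp add: M'_def mat2_simps algebra_simps)
  ultimately show ?thesis
    using that[of M'] sq assms by simp
qed

lemma group_GL2Z: "group GL2Z"
proof (rule groupI)
  show "\<exists>y\<in>carrier GL2Z. y \<otimes>\<^bsub>GL2Z\<^esub> x = \<one>\<^bsub>GL2Z\<^esub>" if "x \<in> carrier GL2Z" for x
    using that GL2Z_left_inverse[of x] by (metis carrier_GL2Z mult_GL2Z one_GL2Z)
qed (auto simp: det_mul abs_mult matrix_mul_assoc)

lemma matrix_mul_minus [simp]:
  fixes M M' :: "int^2^2"
  shows "(- M) ** M' = - (M ** M')" "M ** (- M') = - (M ** M')"
  by (simp_all add: mat2_simps)

lemma det_minus2 [simp]: "det (- M) = det (M :: int^2^2)"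
  by (simp add: det_2)

lemma normal_PGL2Z: "{mat 1, - mat 1} \<lhd> GL2Z"
proof -
  interpret group GL2Z by (rule group_GL2Z)
  have "m_inv GL2Z (mat 1) = mat 1"
    using inv_one by simp
  moreover have "m_inv GL2Z (- mat 1) = - mat 1"
    by (rule inv_equality) auto
  ultimately have "subgroup {mat 1, - mat 1} GL2Z"
    by (intro subgroupI) auto
  then show ?thesis
    by (rule normalI) (auto simp: r_coset_def l_coset_def)
qed

lemma group_PGL2Z: "group PGL2Z"
  unfolding PGL2Z_def by (rule normal.factorgroup_is_group[OF normal_PGL2Z])

lemma pgl_hom: "pgl \<in> hom GL2Z PGL2Z"
  using normal.r_coset_hom_Mod[OF normal_PGL2Z] by (simp add: PGL2Z_def pgl_def[abs_def])

interpretation PGL2Z: group PGL2Z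
  by (rule group_PGL2Z)

interpretation pgl: group_hom GL2Z PGL2Z pgl
  by (simp add: group_hom_def group_hom_axioms_def group_GL2Z group_PGL2Z pgl_hom)

lemma pgl_mult:
  "\<bar>det M\<bar> = 1 \<Longrightarrow> \<bar>det M'\<bar> = 1 \<Longrightarrow> pgl (M ** M') = pgl M \<otimes>\<^bsub>PGL2Z\<^esub> pgl M'"
  using pgl.hom_mult[of M M'] by simp

lemma pgl_eq: "pgl M = {M, - M}"
  by (auto simp: pgl_def r_coset_def)

lemma pgl_eq_iff: "pgl M = pgl M' \<longleftrightarrow> M = M' \<or> M = - M'"
  by (auto simp: pgl_eq doubleton_eq_iff)

lemma pgl_carrier_cases:
  assumes "X \<in> carrier PGL2Z"
  obtains M where "\<bar>det M\<bar> = 1" "X = pgl M"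
  using assms by (auto simp: PGL2Z_def FactGroup_def RCOSETS_def pgl_def)

lemma pgl_mult_right_cong: "pgl M = pgl M' \<Longrightarrow> pgl (M ** K) = pgl (M' ** K)"
  by (auto simp: pgl_eq_iff)

lemma det_inv_GL2Z: "\<bar>det M\<bar> = 1 \<Longrightarrow> \<bar>det (inv\<^bsub>GL2Z\<^esub> M)\<bar> = 1"
  using group.inv_closed[OF group_GL2Z, of M] by simp

lemma inv_GL2Z_mult:
  "\<bar>det M\<bar> = 1 \<Longrightarrow> inv\<^bsub>GL2Z\<^esub> M ** M = mat 1"
  "\<bar>det M\<bar> = 1 \<Longrightarrow> M ** inv\<^bsub>GL2Z\<^esub> M = mat 1"
  using group.l_inv[OF group_GL2Z, of M] group.r_inv[OF group_GL2Z, of M] by simp_all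

text \<open>Homogeneous coordinates \<open>[u : v]\<close>. A matrix acts on them linearly, so
  composition and the later estimates treat infinity like any other point;
  \<open>-\<infinity>\<close> has no coordinates.\<close>

definition homog :: "real \<Rightarrow> real \<Rightarrow> ereal \<Rightarrow> bool" where
  "homog u v x \<longleftrightarrow> (u, v) \<noteq> (0, 0) \<and> x = (if v = 0 then \<infinity> else ereal (u / v))"

lemma homog_exists:
  assumes "x \<noteq> - \<infinity>"
  obtains u v where "homog u v x"
  using assms by (cases x) (auto simp: homog_def intro: that[of _ 1] that[of 1 0])

lemma homog_unique: "homog u v x \<Longrightarrow> homog u v y \<Longrightarrow> x = y"
  by (simp add: homog_def)

lemma homog_not_MInf: "homog u v x \<Longrightarrow> x \<noteq> - \<infinity>"
  by (auto simp: homog_def)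

lemma homog_nonneg:
  assumes "x \<in> {0..\<infinity>}"
  obtains u v where "homog u v x" "0 \<le> u" "0 \<le> v"
  using assms by (cases x) (auto simp: homog_def intro: that[of _ 1] that[of 1 0])

lemma homog_moebius:
  assumes "det M \<noteq> 0" "homog u v x"
  shows "homog (of_int (M$1$1) * u + of_int (M$1$2) * v)
    (of_int (M$2$1) * u + of_int (M$2$2) * v) (moebius M x)"
proof -
  define a b c d where "a = real_of_int (M$1$1)" "b = real_of_int (M$1$2)"
    "c = real_of_int (M$2$1)" "d = real_of_int (M$2$2)"
  have "real_of_int (det M) \<noteq> 0"
    using assms(1) by simp
  then have D: "a * d - b * c \<noteq> 0"
    by (simp add: det_2 a_b_c_d_def mult.commute)
  have nz: "(a * u + b * v, c * u + d * v) \<noteq> (0, 0)"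
  proof
    assume "(a * u + b * v, c * u + d * v) = (0, 0)"
    then have e: "a * u + b * v = 0" "c * u + d * v = 0" by auto
    \<comment> \<open>Cramer's rule: a nonsingular matrix sends only the zero vector to
      zero.\<close>
    have "(a * d - b * c) * u = d * (a * u + b * v) - b * (c * u + d * v)"
      "(a * d - b * c) * v = a * (c * u + d * v) - c * (a * u + b * v)"
      by (simp_all add: algebra_simps)
    with e D have "u = 0" "v = 0" by auto
    with assms(2) show False by (simp add: homog_def)
  qed
  show ?thesis
  proof (cases "v = 0")
    case True
    with assms(2) have "u \<noteq> 0" "x = \<infinity>" by (auto simp: homog_def)
    with True nz show ?thesis
      by (auto simp: homog_def moebius_def Let_def a_b_c_d_def)
  next
    case False
    with assms(2) have x: "x = ereal (u / v)" by (auto simp: homog_def)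
    have "c * (u / v) + d = (c * u + d * v) / v" "a * (u / v) + b = (a * u + b * v) / v"
      using False by (simp_all add: field_simps)
    with nz False show ?thesis
      unfolding homog_def moebius_def Let_def x a_b_c_d_def[symmetric] by auto
  qed
qed

lemma moebius_mult:
  assumes "det M \<noteq> 0" "det M' \<noteq> 0" "x \<noteq> - \<infinity>"
  shows "moebius (M ** M') x = moebius M (moebius M' x)"
proof -
  obtain u v where uv: "homog u v x"
    using assms(3) by (rule homog_exists)
  have "det (M ** M') \<noteq> 0"
    using assms by (simp add: det_mul)
  from homog_moebius[OF this uv] homog_moebius[OF assms(1) homog_moebius[OF assms(2) uv]]
  show ?thesis
    by (auto simp: mat2_simps algebra_simps intro: homog_unique)
qed

lemma moebius_one: "x \<noteq> - \<infinity> \<Longrightarrow> moebius (mat 1) x = x"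
  by (cases x) (auto simp: moebius_def mat_def)

lemma moebius_minus: "moebius (- M) x = moebius M x"
proof -
  have "(- p - q) / (- r - s) = (p + q) / (r + s)" for p q r s :: real
    using minus_divide_divide[of "p + q" "r + s"] by simp
  then show ?thesis
    by (cases x) (auto simp: moebius_def Let_def)
qed

lemma pgl_act_pgl: "pgl_act (pgl M) x = moebius M x"
  by (simp add: pgl_act_def pgl_eq moebius_minus)

text \<open>\<open>moebius\<close> at irrational points, in real arithmetic: there the denominator
  does not vanish. At a pole the division gives 0 instead of infinity, hence the irrationality
  hypotheses of the lemmas that follow.\<close>

definition act :: "int^2^2 \<Rightarrow> real \<Rightarrow> real" where
  "act M r = (of_int (M$1$1) * r + of_int (M$1$2)) / (of_int (M$2$1) * r + of_int (M$2$2))"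

lemma denominator_nonzero:
  fixes M :: "int^2^2"
  assumes "\<bar>det M\<bar> = 1" "r \<notin> \<rat>"
  shows "real_of_int (M$2$1) * r + of_int (M$2$2) \<noteq> 0"
proof
  assume eq: "real_of_int (M$2$1) * r + of_int (M$2$2) = 0"
  show False
  proof (cases "M$2$1 = 0")
    case True
    with eq assms(1) show False by (simp add: det_2)
  next
    case False
    with eq have "r = - of_int (M$2$2) / of_int (M$2$1)"
      by (simp add: field_simps eq_neg_iff_add_eq_0)
    with assms(2) show False by simp
  qed
qed

lemma moebius_ereal:
  "\<bar>det M\<bar> = 1 \<Longrightarrow> r \<notin> \<rat> \<Longrightarrow> moebius M (ereal r) = ereal (act M r)"
  using denominator_nonzero[of M r] by (simp add: moebius_def act_def)

lemma act_mult:
  assumes "\<bar>det M'\<bar> = 1" "r \<notin> \<rat>"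
  shows "act (M ** M') r = act M (act M' r)"
proof -
  define s where "s = real_of_int (M'$2$1) * r + of_int (M'$2$2)"
  define q where "q = real_of_int (M'$1$1) * r + of_int (M'$1$2)"
  have s: "s \<noteq> 0"
    unfolding s_def by (rule denominator_nonzero[OF assms])
  have "x * (q / s) + y = (x * q + y * s) / s" for x y
    using s by (simp add: field_simps)
  then have "act M (act M' r) = (of_int (M$1$1) * q + of_int (M$1$2) * s) /
      (of_int (M$2$1) * q + of_int (M$2$2) * s)"
    using s by (simp add: act_def flip: s_def q_def)
  then show ?thesis
    by (simp add: act_def s_def q_def mat2_simps algebra_simps)
qed

lemma act_one [simp]: "act (mat 1) r = r"
  by (simp add: act_def mat_def)

lemma act_minus [simp]: "act (- M) r = act M r"
proof -
  have "(- p) / (- q) = p / q" for p q :: real by simp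
  from this[of "of_int (M$1$1) * r + of_int (M$1$2)" "of_int (M$2$1) * r + of_int (M$2$2)"]
  show ?thesis by (simp add: act_def)
qed

lemma act_pgl_cong: "pgl M = pgl M' \<Longrightarrow> act M r = act M' r"
  by (auto simp: pgl_eq_iff)

lemma act_inv:
  assumes "\<bar>det M\<bar> = 1" "r \<notin> \<rat>"
  shows "act (inv\<^bsub>GL2Z\<^esub> M) (act M r) = r" "act M (act (inv\<^bsub>GL2Z\<^esub> M) r) = r"
  using assms by (simp_all add: act_mult[symmetric] det_inv_GL2Z inv_GL2Z_mult)

lemma act_irrational [simp]:
  assumes "\<bar>det M\<bar> = 1" "r \<notin> \<rat>"
  shows "act M r \<notin> \<rat>"
proof
  assume "act M r \<in> \<rat>"
  then have "act (inv\<^bsub>GL2Z\<^esub> M) (act M r) \<in> \<rat>"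
    unfolding act_def[of "inv\<^bsub>GL2Z\<^esub> M"] by (intro Rats_divide Rats_add Rats_mult) auto
  with assms show False by (simp add: act_inv)
qed

lemma act_inj:
  assumes "\<bar>det M\<bar> = 1" "r \<notin> \<rat>" "s \<notin> \<rat>" "act M r = act M s"
  shows "r = s"
  using assms act_inv(1) by metis

lemma act_pos:
  assumes "\<bar>det M\<bar> = 1" "\<And>i j. 0 \<le> M$i$j" "0 < r"
  shows "0 < act M r"
proof -
  have "0 < real_of_int (M$i$1) * r + of_int (M$i$2)" if "M$i$1 \<noteq> 0 \<or> M$i$2 \<noteq> 0" for i
    using that assms(2)[of i 1] assms(2)[of i 2] assms(3)
    by (smt (verit, best) mult_pos_pos mult_nonneg_nonneg of_int_0_less_iff of_int_0_le_iff)
  moreover have "M$i$1 \<noteq> 0 \<or> M$i$2 \<noteq> 0" for i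
    using assms(1) exhaust_2[of i] by (auto simp: det_2)
  ultimately show ?thesis by (simp add: act_def)
qed

section \<open>Words in L and N\<close>

declare gmat.simps [simp del]

lemma gmat_entries [simp]:
  "gmat L $1$1 = 1" "gmat L $1$2 = 0" "gmat L $2$1 = 1" "gmat L $2$2 = 1"
  "gmat N $1$1 = 1" "gmat N $1$2 = 1" "gmat N $2$1 = 0" "gmat N $2$2 = 1"
  "gmat F $1$1 = 0" "gmat F $1$2 = 1" "gmat F $2$1 = 1" "gmat F $2$2 = 0"
  by (simp_all add: gmat.simps)

lemma mat_1_entries [simp]:
  fixes x :: "'a::zero"
  shows "(mat x :: 'a^2^2) $1$1 = x" "(mat x :: 'a^2^2) $1$2 = 0"
    "(mat x :: 'a^2^2) $2$1 = 0" "(mat x :: 'a^2^2) $2$2 = x"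
  by (simp_all add: mat_def)

lemma matrix_mult_entry: "(M ** K) $ i $ j = M$i$1 * K$1$j + M$i$2 * K$2$j"
  for M K :: "int^2^2"
  by (simp add: matrix_matrix_mult_def sum_2)

lemma det_gmat [simp]: "\<bar>det (gmat g)\<bar> = 1"
  by (cases g) (simp_all add: det_2)

lemma wmat_simps [simp]: "wmat [] = mat 1" "wmat (g # w) = gmat g ** wmat w"
  by (simp_all add: wmat_def)

lemma wmat_append: "wmat (v @ w) = wmat v ** wmat w"
  by (induction v) (simp_all add: matrix_mul_assoc)

lemma det_wmat [simp]: "\<bar>det (wmat w)\<bar> = 1"
  by (induction w) (simp_all add: det_mul abs_mult)

lemma det_wmat_LN: "set w \<subseteq> {L, N} \<Longrightarrow> det (wmat w) = 1"
  by (induction w) (auto simp: det_mul, auto simp: det_2)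

lemma det_Fpow [simp]: "\<bar>det (Fpow c)\<bar> = 1" and det_Fpow_eq: "det (Fpow c) = (if c then - 1 else 1)"
  by (simp_all add: Fpow_def det_2)

lemma wmat_nonneg: "0 \<le> wmat w $ i $ j"
proof (induction w arbitrary: i j)
  case Nil
  then show ?case by (simp add: mat_def)
next
  case (Cons g w)
  have "0 \<le> gmat g $ k $ l" for k l
    using exhaust_2[of k] exhaust_2[of l] by (cases g) auto
  with Cons show ?case by (simp add: matrix_mult_entry)
qed

lemma Fpow_nonneg: "0 \<le> Fpow c $ i $ j"
  using exhaust_2[of i] exhaust_2[of j] by (auto simp: Fpow_def mat_def)

lemma Fpow_mult: "Fpow c ** Fpow d = Fpow (c \<noteq> d)"
  by (cases c; cases d) (simp_all add: Fpow_def mat2_simps)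

definition twist :: "bool \<Rightarrow> gen list \<Rightarrow> gen list" where
  "twist c w = (if c then map twin_label w else w)"

lemma length_twist [simp]: "length (twist c w) = length w"
  by (simp add: twist_def)

lemma twin_label_LN: "twin_label g \<in> {L, N} \<longleftrightarrow> g \<in> {L, N}"
  by (cases g) auto

lemma set_twist [simp]: "set (twist c w) \<subseteq> {L, N} \<longleftrightarrow> set w \<subseteq> {L, N}"
  using twin_label_LN by (auto simp: twist_def subset_iff)

lemma twin_label_involution [simp]: "twin_label (twin_label g) = g"
  by (cases g) auto

lemma twist_twist [simp]: "twist c (twist c w) = w"
  by (simp add: twist_def o_def)

lemma Fpow_wmat: "Fpow c ** wmat w = wmat (twist c w) ** Fpow c"
proof -
  have *: "gmat F ** gmat g = gmat (twin_label g) ** gmat F" for g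
    by (cases g) (simp_all add: vec_eq_iff forall_2 matrix_mult_entry)
  have "gmat F ** wmat w = wmat (map twin_label w) ** gmat F"
  proof (induction w)
    case (Cons g w)
    then show ?case
      by (simp add: matrix_mul_assoc *) (simp flip: matrix_mul_assoc)
  qed simp
  then show ?thesis
    by (simp add: Fpow_def twist_def)
qed

section \<open>The word of a positive irrational number\<close>

lemma act_gmat:
  "act (gmat L) r = r / (r + 1)" "act (gmat N) r = r + 1" "act (gmat F) r = 1 / r"
  by (simp_all add: act_def)

lemma act_wmat_pos: "0 < x \<Longrightarrow> 0 < act (wmat w) x"
  by (rule act_pos) (simp_all add: wmat_nonneg)

lemma act_Fpow_pos: "0 < x \<Longrightarrow> 0 < act (Fpow c) x"
  by (rule act_pos) (simp_all add: Fpow_nonneg)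

text \<open>\<open>L\<close> maps the positive numbers below 1 and \<open>N\<close> maps them above
  1, so the common value fixes the first letter; injectivity then removes it.\<close>

lemma LN_word_unique:
  assumes "length w = length w'" "set w \<subseteq> {L, N}" "set w' \<subseteq> {L, N}"
    "0 < x" "x \<notin> \<rat>" "0 < x'" "x' \<notin> \<rat>" "act (wmat w) x = act (wmat w') x'"
  shows "w = w' \<and> x = x'"
  using assms(1-3,8)
proof (induction w w' rule: list_induct2)
  case Nil
  then show ?case by simp
next
  case (Cons g w g' w')
  let ?y = "act (wmat w) x" and ?y' = "act (wmat w') x'"
  have pos: "0 < ?y" "0 < ?y'"
    using assms by (simp_all add: act_wmat_pos)
  have eq: "act (gmat g) ?y = act (gmat g') ?y'"
    using Cons.prems(3) assms by (simp add: act_mult)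
  have range: "act (gmat L) r < 1 \<and> 1 < act (gmat N) r" if "0 < r" for r
    using that by (simp add: act_gmat)
  have g: "g \<in> {L, N}" "g' \<in> {L, N}"
    using Cons.prems by auto
  then have "g = g'"
    using range[OF pos(1)] range[OF pos(2)] eq by auto
  moreover have "?y = ?y'"
    using act_inj[of "gmat g" ?y ?y'] eq \<open>g = g'\<close> assms by simp
  ultimately show ?case
    using Cons.IH Cons.prems by simp
qed

lemma act_Fpow_Fpow:
  assumes "r \<notin> \<rat>"
  shows "act (Fpow c) (act (Fpow c) r) = r"
proof -
  have "Fpow c ** Fpow c = mat 1"
    by (simp add: Fpow_mult) (simp add: Fpow_def)
  with assms show ?thesis
    by (simp flip: act_mult)
qed

lemma act_Fpow_wmat:
  assumes "r \<notin> \<rat>"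
  shows "act (Fpow c) (act (wmat w) r) = act (wmat (twist c w)) (act (Fpow c) r)"
proof -
  have "act (Fpow c ** wmat w) r = act (wmat (twist c w) ** Fpow c) r"
    by (simp only: Fpow_wmat)
  with assms show ?thesis
    by (simp add: act_mult)
qed

text \<open>The first \<open>s\<close> letters of the infinite word of \<open>r\<close>. Leaving a
  positive irrational remainder \<open>x\<close> characterizes them, by
  \<open>LN_word_unique\<close>.\<close>

definition LN_prefix :: "real \<Rightarrow> nat \<Rightarrow> gen list" where
  "LN_prefix r s = (THE w. length w = s \<and> set w \<subseteq> {L, N} \<and>
    (\<exists>x>0. x \<notin> \<rat> \<and> r = act (wmat w) x))"

lemma LN_prefix_eqI:
  assumes "set w \<subseteq> {L, N}" "0 < x" "x \<notin> \<rat>" "r = act (wmat w) x"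
  shows "LN_prefix r (length w) = w"
  unfolding LN_prefix_def
proof (rule the_equality)
  fix v
  assume v: "length v = length w \<and> set v \<subseteq> {L, N} \<and> (\<exists>x>0. x \<notin> \<rat> \<and> r = act (wmat v) x)"
  then obtain y where "0 < y" "y \<notin> \<rat>" "r = act (wmat v) y" by blast
  with v assms show "v = w"
    using LN_word_unique[of v w y x] by simp
qed (use assms in blast)

lemma LN_prefix_exists:
  assumes "0 < r" "r \<notin> \<rat>"
  obtains x where "0 < x" "x \<notin> \<rat>" "r = act (wmat (LN_prefix r s)) x"
    "length (LN_prefix r s) = s" "set (LN_prefix r s) \<subseteq> {L, N}"
proof -
  have "\<exists>w x. length w = s \<and> set w \<subseteq> {L, N} \<and> 0 < x \<and> x \<notin> \<rat> \<and> r = act (wmat w) x"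
  proof (induction s)
    case 0
    then show ?case using assms by auto
  next
    case (Suc s)
    then obtain w x where w: "length w = s" "set w \<subseteq> {L, N}" "0 < x" "x \<notin> \<rat>"
      "r = act (wmat w) x" by blast
    \<comment> \<open>One step of the subtractive Euclidean algorithm; irrationality excludes
      \<open>x = 1\<close>, from which neither letter can be split off.\<close>
    have "\<exists>g\<in>{L, N}. \<exists>y>0. y \<notin> \<rat> \<and> x = act (gmat g) y"
    proof (cases "1 < x")
      case True
      have "x - 1 \<notin> \<rat>"
        using w(4) Rats_add[of "x - 1" 1] by auto
      with True show ?thesis by (auto simp: act_gmat intro!: exI[of _ "x - 1"])
    next
      case False
      with w(4) have "x < 1" by (cases "x = 1") auto
      define y where "y = x / (1 - x)"
      have "0 < y" "x = act (gmat L) y"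
        using \<open>x < 1\<close> w(3) by (simp_all add: y_def act_gmat field_simps)
      moreover from this have "y \<notin> \<rat>"
        using w(4) by (auto simp: act_gmat)
      ultimately show ?thesis by blast
    qed
    then obtain g y where "g \<in> {L, N}" "0 < y" "y \<notin> \<rat>" "x = act (gmat g) y" by blast
    with w show ?case
      by (intro exI[of _ "w @ [g]"] exI[of _ y]) (simp add: wmat_append act_mult)
  qed
  then obtain w x where wx: "length w = s" "set w \<subseteq> {L, N}" "0 < x" "x \<notin> \<rat>"
    "r = act (wmat w) x" by blast
  have eq: "LN_prefix r s = w"
    using LN_prefix_eqI[OF wx(2-5)] wx(1) by simp
  show ?thesis
    by (rule that[of x, unfolded eq]) fact+
qed

lemma LN_prefix_take:
  assumes "0 < r" "r \<notin> \<rat>" "s \<le> s'"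
  shows "LN_prefix r s = take s (LN_prefix r s')"
proof -
  obtain x where x: "0 < x" "x \<notin> \<rat>" "r = act (wmat (LN_prefix r s')) x"
    "length (LN_prefix r s') = s'" "set (LN_prefix r s') \<subseteq> {L, N}"
    using LN_prefix_exists[OF assms(1,2)] by blast
  define v z where "v = take s (LN_prefix r s')" and "z = drop s (LN_prefix r s')"
  have eq: "LN_prefix r s' = v @ z"
    by (simp add: v_def z_def)
  have "r = act (wmat v) (act (wmat z) x)"
    using x(2,3) unfolding eq by (simp add: wmat_append act_mult)
  moreover have "set v \<subseteq> {L, N}"
    using x(5) unfolding eq by simp
  ultimately have "LN_prefix r (length v) = v"
    using LN_prefix_eqI[of v "act (wmat z) x" r] x(1,2) by (simp add: act_wmat_pos)
  moreover have "length v = s"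
    using x(4) assms(3) by (simp add: v_def z_def)
  ultimately show ?thesis
    by (simp add: v_def z_def)
qed

text \<open>Let \<open>s\<close>, \<open>t\<close> be the column sums. Appending \<open>L\<close>
  changes them to \<open>s + t\<close>, \<open>t\<close> and appending \<open>N\<close> to
  \<open>s\<close>, \<open>s + t\<close>, so their product grows by a square that is at least
  1.\<close>

lemma column_sums_ge:
  assumes "set w \<subseteq> {L, N}"
  shows "int (length w) + 1 \<le>
    (wmat w $1$1 + wmat w $2$1) * (wmat w $1$2 + wmat w $2$2)"
proof -
  let ?s = "wmat w $1$1 + wmat w $2$1" and ?t = "wmat w $1$2 + wmat w $2$2"
  have "int (length w) + 1 \<le> ?s * ?t \<and> 1 \<le> ?s \<and> 1 \<le> ?t"
    using assms
  proof (induction w rule: rev_induct)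
    case Nil
    show ?case by simp
  next
    case (snoc g w)
    define s t where "s = wmat w $1$1 + wmat w $2$1" "t = wmat w $1$2 + wmat w $2$2"
    have IH: "int (length w) + 1 \<le> s * t" "1 \<le> s" "1 \<le> t"
      using snoc by (auto simp: s_t_def)
    have "g = L \<or> g = N" using snoc.prems by auto
    then show ?case
    proof
      assume "g = L"
      then have "wmat (w @ [g]) $1$1 + wmat (w @ [g]) $2$1 = s + t"
        "wmat (w @ [g]) $1$2 + wmat (w @ [g]) $2$2 = t"
        by (simp_all add: wmat_append matrix_mult_entry s_t_def)
      moreover have "t * t \<ge> 1" using IH mult_mono[of 1 t 1 t] by simp
      ultimately show ?thesis using IH by (simp add: algebra_simps)
    next
      assume "g = N"
      then have "wmat (w @ [g]) $1$1 + wmat (w @ [g]) $2$1 = s"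
        "wmat (w @ [g]) $1$2 + wmat (w @ [g]) $2$2 = s + t"
        by (simp_all add: wmat_append matrix_mult_entry s_t_def)
      moreover have "s * s \<ge> 1" using IH mult_mono[of 1 s 1 s] by simp
      ultimately show ?thesis using IH by (simp add: algebra_simps)
    qed
  qed
  then show ?thesis by simp
qed

text \<open>Each leading \<open>N\<close> leaves the denominators alone but raises the value by 1,
  which accounts for the subtracted term. At the first \<open>L\<close> the denominators become the
  column sums of the rest, and \<open>column_sums_ge\<close> applies.\<close>

lemma denominators_ge:
  assumes "set w \<subseteq> {L, N}" "0 < x" "x \<notin> \<rat>"
  shows "real (length w) - act (wmat w) x \<le> of_int (wmat w $2$1 * wmat w $2$2)"
  using assms(1)
proof (induction w)
  case Nil
  then show ?case using assms by simp
next
  case (Cons g w)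
  have y: "0 < act (wmat w) x" using assms(2) by (rule act_wmat_pos)
  have mult: "act (wmat (g # w)) x = act (gmat g) (act (wmat w) x)"
    using assms by (simp add: act_mult)
  have "g = L \<or> g = N" using Cons.prems by auto
  then show ?case
  proof
    assume "g = N"
    then have "wmat (g # w) $2$1 = wmat w $2$1" "wmat (g # w) $2$2 = wmat w $2$2"
      by (simp_all add: matrix_mult_entry)
    with Cons \<open>g = N\<close> mult show ?thesis by (simp add: act_gmat)
  next
    assume "g = L"
    then have "wmat (g # w) $2$1 * wmat (g # w) $2$2 =
        (wmat w $1$1 + wmat w $2$1) * (wmat w $1$2 + wmat w $2$2)"
      by (simp add: matrix_mult_entry)
    moreover have "int (length w) + 1 \<le> \<dots>"
      using Cons.prems by (intro column_sums_ge) auto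
    ultimately have "real_of_int (int (length (g # w))) \<le>
        of_int (wmat (g # w) $2$1 * wmat (g # w) $2$2)"
      unfolding of_int_le_iff by simp
    moreover have "0 \<le> act (wmat (g # w)) x"
      using assms(2) by (intro less_imp_le act_wmat_pos)
    ultimately show ?thesis by simp
  qed
qed

text \<open>If one row dominates the other entrywise, subtracting the smaller row splits off
  \<open>N\<close> or \<open>L\<close> and lowers the sum of the entries. If neither does, the
  determinant forces the identity or \<open>F\<close>.\<close>

lemma nonneg_factorization:
  assumes "\<bar>det M\<bar> = 1" "\<And>i j. 0 \<le> M$i$j"
  obtains w c where "set w \<subseteq> {L, N}" "M = wmat w ** Fpow c"
proof -
  have "\<exists>w c. set w \<subseteq> {L, N} \<and> M = wmat w ** Fpow c"
    using assms
  proof (induction "nat (M$1$1 + M$1$2 + M$2$1 + M$2$2)" arbitrary: M rule: less_induct)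
    case less
    define p p' q q' where e: "p = M$1$1" "p' = M$1$2" "q = M$2$1" "q' = M$2$2"
    have nn: "0 \<le> p" "0 \<le> p'" "0 \<le> q" "0 \<le> q'"
      using less.prems(2) by (auto simp: e)
    have D: "\<bar>p * q' - p' * q\<bar> = 1"
      using less.prems(1) by (simp add: e det_2)
    have step: ?case
      if g: "g \<in> {L, N}" and M: "M = gmat g ** K" and K: "\<forall>i j. 0 \<le> K$i$j"
        and lt: "K$1$1 + K$1$2 + K$2$1 + K$2$2 < p + p' + q + q'" for g K
    proof -
      have "\<bar>det K\<bar> = 1"
        using less.prems(1) M by (simp add: det_mul abs_mult)
      moreover have "0 \<le> K$1$1 + K$1$2 + K$2$1 + K$2$2"
        using K by (intro add_nonneg_nonneg) auto
      with lt have "nat (K$1$1 + K$1$2 + K$2$1 + K$2$2) < nat (M$1$1 + M$1$2 + M$2$1 + M$2$2)"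
        by (simp only: nat_less_eq_zless e)
      ultimately obtain w c where "set w \<subseteq> {L, N}" "K = wmat w ** Fpow c"
        using less.hyps K by blast
      with g M show ?thesis
        by (intro exI[of _ "g # w"] exI[of _ c]) (simp add: matrix_mul_assoc)
    qed
    consider "q \<le> p" "q' \<le> p'" | "p \<le> q" "p' \<le> q'" | "q < p" "p' < q'" | "p < q" "q' < p'"
      by linarith
    then show ?case
    proof cases
      case 1
      define K :: "int^2^2" where "K = vector [vector [p - q, p' - q'], vector [q, q']]"
      have "q \<noteq> 0 \<or> q' \<noteq> 0" using D by auto
      with 1 nn show ?thesis
        by (intro step[of N K]) (auto simp: K_def mat2_simps e)
    next
      case 2
      define K :: "int^2^2" where "K = vector [vector [p, p'], vector [q - p, q' - p']]"
      have "p \<noteq> 0 \<or> p' \<noteq> 0" using D by auto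
      with 2 nn show ?thesis
        by (intro step[of L K]) (auto simp: K_def mat2_simps e)
    next
      case 3
      \<comment> \<open>The strict inequalities bound the determinant below by
        \<open>q + p' + 1\<close>, so both off-diagonal entries vanish.\<close>
      have "(q + 1) * (p' + 1) \<le> p * q'"
        using 3 nn by (intro mult_mono) auto
      then have "p * q' - p' * q \<ge> q + p' + 1" by (simp add: algebra_simps)
      with D nn have "q = 0" "p' = 0" by auto
      with D have "p * q' = 1" using nn by simp
      with nn have "p = 1" "q' = 1" by (auto simp: zmult_eq_1_iff)
      with \<open>q = 0\<close> \<open>p' = 0\<close> show ?thesis
        by (intro exI[of _ "[]"] exI[of _ False]) (auto simp: Fpow_def mat2_simps e)
    next
      case 4
      have "(p + 1) * (q' + 1) \<le> q * p'"
        using 4 nn by (intro mult_mono) auto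
      then have "p' * q - p * q' \<ge> p + q' + 1" by (simp add: algebra_simps)
      with D nn have "p = 0" "q' = 0" by auto
      with D have "p' * q = 1" using nn by simp
      with nn have "p' = 1" "q = 1" by (auto simp: zmult_eq_1_iff)
      with \<open>p = 0\<close> \<open>q' = 0\<close> show ?thesis
        by (intro exI[of _ "[]"] exI[of _ True]) (auto simp: Fpow_def mat2_simps e)
    qed
  qed
  then show ?thesis using that by blast
qed

section \<open>Freeness of the monoid of L and N, and the factorization of branches\<close>

lemma irrational_exists: obtains x :: real where "0 < x" "x \<notin> \<rat>"
proof -
  have "\<not> {0<..<1::real} \<subseteq> \<rat>"
    using countable_rat countable_subset uncountable_open_interval[of 0 "1::real"] by auto
  then show ?thesis using that by (meson greaterThanLessThan_iff subsetI)
qed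

text \<open>Evaluation at an irrational point shows that the shorter word is a prefix of the longer
  one. The remaining word has the identity as its matrix, and \<open>column_sums_ge\<close> makes it
  empty.\<close>

lemma wmat_LN_inj:
  assumes "set w \<subseteq> {L, N}" "set w' \<subseteq> {L, N}" "wmat w = wmat w'"
  shows "w = w'"
  using assms
proof (induction "length w" "length w'" arbitrary: w w' rule: linorder_wlog)
  case (le w w')
  obtain x :: real where x: "0 < x" "x \<notin> \<rat>" by (rule irrational_exists)
  obtain v z where w': "w' = v @ z" "length w = length v"
    using le.hyps by (metis append_take_drop_id length_take min.absorb2)
  have mat: "wmat w = wmat v ** wmat z"
    using le.prems(3) w'(1) by (simp add: wmat_append)
  have LN: "set v \<subseteq> {L, N}" "set z \<subseteq> {L, N}"
    using le.prems(2) w'(1) by auto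
  have "act (wmat w) x = act (wmat v) (act (wmat z) x)"
    using x mat by (simp add: act_mult)
  then have "w = v"
    using LN_word_unique[of w v x "act (wmat z) x"] w'(2) le.prems(1) LN(1) x
    by (simp add: act_wmat_pos)
  from arg_cong[OF mat, of "\<lambda>X. inv\<^bsub>GL2Z\<^esub> (wmat w) ** X"] have "wmat z = mat 1"
    unfolding \<open>w = v\<close> matrix_mul_assoc by (simp add: inv_GL2Z_mult)
  then have "z = []"
    using column_sums_ge[OF LN(2)] by simp
  with \<open>w = v\<close> show ?case
    by (simp add: w'(1))
next
  case (sym w w')
  show ?case
    by (rule sym(1)[OF refl refl sym.prems(2,1) sym.prems(3)[symmetric], symmetric])
qed

text \<open>Words in L, N have determinant 1, so the determinant settles the exponent of
  \<open>F\<close>; freeness then settles the word.\<close>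

lemma LN_factor_eq:
  assumes "set w \<subseteq> {L, N}" "M = wmat w ** Fpow c"
  shows "LN_factor M = (w, c)"
  unfolding LN_factor_def
proof (rule the_equality)
  fix p assume "case p of (w, e) \<Rightarrow> set w \<subseteq> {L, N} \<and> M = wmat w ** Fpow e"
  then obtain w' e where p: "p = (w', e)" "set w' \<subseteq> {L, N}" "M = wmat w' ** Fpow e"
    by (cases p) auto
  have "det M = det (Fpow c)"
    by (simp add: assms det_mul det_wmat_LN)
  moreover have "det M = det (Fpow e)"
    using p(2) by (simp add: p(3) det_mul det_wmat_LN)
  ultimately have "e = c" by (auto simp: det_Fpow_eq split: if_splits)
  with assms p have "wmat w ** Fpow c ** Fpow c = wmat w' ** Fpow c ** Fpow c" by simp
  then have "wmat w = wmat w'"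
    by (simp add: Fpow_mult flip: matrix_mul_assoc) (simp add: Fpow_def)
  with wmat_LN_inj p \<open>e = c\<close> assms show "p = (w, c)" by simp
qed (use assms in simp)

lemma LN_factor:
  assumes "\<bar>det M\<bar> = 1" "\<And>i j. 0 \<le> M$i$j"
  shows "set (B_word M) \<subseteq> {L, N}" "M = wmat (B_word M) ** Fpow (e_exp M)"
proof -
  obtain w c where "set w \<subseteq> {L, N}" "M = wmat w ** Fpow c"
    using nonneg_factorization assms by blast
  then show "set (B_word M) \<subseteq> {L, N}" "M = wmat (B_word M) ** Fpow (e_exp M)"
    using LN_factor_eq[of w M c] by simp_all
qed

section \<open>Convergence along prefixes\<close>

text \<open>Both points lie in the image of \<open>[0, \<infinity>]\<close> under the word, an
  interval of length \<open>1/(q q')\<close> because the determinant is 1. The coordinates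
  \<open>(1, 0)\<close> and \<open>(0, 1)\<close> give its endpoints.\<close>

lemma wmat_approximation:
  fixes w u v x
  defines "p \<equiv> real_of_int (wmat w $1$1)" and "p' \<equiv> real_of_int (wmat w $1$2)"
    and "q \<equiv> real_of_int (wmat w $2$1)" and "q' \<equiv> real_of_int (wmat w $2$2)"
  assumes "set w \<subseteq> {L, N}" "0 < x" "0 \<le> u" "0 \<le> v" "(u, v) \<noteq> (0, 0)" "0 < q" "0 < q'"
  shows "\<bar>(p * u + p' * v) / (q * u + q' * v) - act (wmat w) x\<bar> \<le> 1 / (q * q')"
proof -
  have D: "p * q' - p' * q = 1"
  proof -
    have "real_of_int (det (wmat w)) = 1"
      using det_wmat_LN assms(5) by simp
    then show ?thesis by (simp add: det_2 p_def p'_def q_def q'_def)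
  qed
  have pos: "0 < q * u + q' * v" "0 < q * x + q'"
  proof -
    have "0 \<le> q * u" "0 \<le> q' * v" "0 < q * x"
      using assms(6-11) by simp_all
    moreover have "0 < q * u \<or> 0 < q' * v"
      using assms(7-11) by (metis less_eq_real_def mult_pos_pos)
    ultimately show "0 < q * u + q' * v" "0 < q * x + q'"
      using assms(11) by linarith+
  qed
  have "(p * u + p' * v) / (q * u + q' * v) - act (wmat w) x =
      ((p * u + p' * v) * (q * x + q') - (p * x + p') * (q * u + q' * v)) /
      ((q * u + q' * v) * (q * x + q'))"
    using pos by (simp add: act_def diff_frac_eq flip: p_def p'_def q_def q'_def)
  also have "(p * u + p' * v) * (q * x + q') - (p * x + p') * (q * u + q' * v) =
      (p * q' - p' * q) * (u - v * x)"
    by (simp add: algebra_simps)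
  finally have "\<bar>(p * u + p' * v) / (q * u + q' * v) - act (wmat w) x\<bar> =
      \<bar>u - v * x\<bar> / ((q * u + q' * v) * (q * x + q'))"
    using pos D by (simp add: abs_mult)
  also have "\<dots> \<le> 1 / (q * q')"
  proof -
    have "0 \<le> v * x"
      using assms(6,8) by simp
    with assms(7) have "\<bar>u - v * x\<bar> \<le> u + v * x"
      by linarith
    then have "\<bar>u - v * x\<bar> * (q * q') \<le> (u + v * x) * (q * q')"
      using assms(10,11) by (intro mult_right_mono) auto
    also have "\<dots> \<le> (q * u + q' * v) * (q * x + q')"
    proof -
      have "0 \<le> q * u * (q * x)" "0 \<le> q' * v * q'"
        using assms(6-11) by simp_all
      then show ?thesis by (simp add: algebra_simps)
    qed
    finally have le: "\<bar>u - v * x\<bar> * (q * q') \<le> (q * u + q' * v) * (q * x + q')" .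
    have "a / c \<le> 1 / b" if "a * b \<le> c" "0 < b" "0 < c" for a b c :: real
      using that by (simp add: field_simps)
    from this[OF le] show ?thesis
      using pos assms(10,11) by simp
  qed
  finally show ?thesis .
qed

lemma LN_prefix_denominators:
  fixes w x
  defines "q \<equiv> wmat w $2$1" and "q' \<equiv> wmat w $2$2"
  assumes "set w \<subseteq> {L, N}" "0 < x" "x \<notin> \<rat>" "0 < k" "act (wmat w) x + k \<le> real (length w)"
  shows "0 < real_of_int q" "0 < real_of_int q'" "1 / (real_of_int q * real_of_int q') \<le> 1 / k"
proof -
  have ge: "k \<le> real_of_int (q * q')"
    using denominators_ge[of w x] assms by simp
  with assms(6) have "0 < real_of_int (q * q')"
    by linarith
  then have "0 < q * q'"
    by (simp only: of_int_0_less_iff)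
  moreover have "0 \<le> q" "0 \<le> q'"
    by (simp_all add: q_def q'_def wmat_nonneg)
  ultimately show "0 < real_of_int q" "0 < real_of_int q'"
    by (auto simp: zero_less_mult_iff)
  show "1 / (real_of_int q * real_of_int q') \<le> 1 / k"
    using ge assms(6) by (intro divide_left_mono) auto
qed

text \<open>Moving the point by \<open>1/k\<close> changes the value by at most
  \<open>|a|/k\<close>; the \<open>+ 1\<close> keeps this strictly below \<open>a r + b\<close> and
  makes \<open>k\<close> positive even for \<open>a = 0\<close>.\<close>

lemma affine_pos_near:
  fixes a b r y :: real
  assumes "0 < a * r + b" "\<bar>y - r\<bar> \<le> 1 / k" "(\<bar>a\<bar> + 1) / (a * r + b) \<le> k"
  shows "0 < a * y + b"
proof -
  have k: "0 < k"
    using assms(1,3) by (smt (verit) divide_pos_pos)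
  have "\<bar>a\<bar> + 1 \<le> k * (a * r + b)"
    using assms(1,3) by (simp add: pos_divide_le_eq)
  have "\<bar>a * (y - r)\<bar> \<le> \<bar>a\<bar> * (1 / k)"
    unfolding abs_mult using assms(2) by (rule mult_left_mono) simp
  also have "\<dots> < a * r + b"
    using \<open>\<bar>a\<bar> + 1 \<le> k * (a * r + b)\<close> k by (simp add: pos_divide_less_eq mult.commute)
  finally show ?thesis
    by (simp add: algebra_simps abs_less_iff)
qed

text \<open>The columns of a long prefix are close to \<open>r\<close> as points, so the two rows of
  \<open>S\<close>, with the sign that makes them positive at \<open>r\<close>, are positive on
  these columns. The product is then nonnegative, and \<open>nonneg_factorization\<close>
  applies.\<close>

lemma LN_prefix_image:
  assumes S: "\<bar>det S\<bar> = 1" and r: "0 < r" "r \<notin> \<rat>" and pos: "0 < act S r"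
  obtains l where "\<And>s. l \<le> s \<Longrightarrow>
    \<exists>w c. set w \<subseteq> {L, N} \<and> pgl (S ** wmat (LN_prefix r s)) = pgl (wmat w ** Fpow c)"
proof -
  \<comment> \<open>Numerator and denominator of \<open>act S r\<close> have the same sign; passing
    to \<open>- S\<close> if necessary makes both positive.\<close>
  have "\<exists>S'. pgl S' = pgl S \<and> \<bar>det S'\<bar> = 1 \<and> 0 < of_int (S'$1$1) * r + of_int (S'$1$2) \<and>
      0 < of_int (S'$2$1) * r + of_int (S'$2$2)"
  proof (cases "0 < real_of_int (S$2$1) * r + of_int (S$2$2)")
    case True
    with pos S show ?thesis
      by (intro exI[of _ S]) (simp add: act_def zero_less_divide_iff)
  next
    case False
    with pos have "real_of_int (S$1$1) * r + of_int (S$1$2) < 0"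
      "real_of_int (S$2$1) * r + of_int (S$2$2) < 0"
      by (auto simp: act_def zero_less_divide_iff)
    with S show ?thesis
      by (intro exI[of _ "- S"]) (simp add: pgl_eq_iff)
  qed
  then obtain S' where S': "pgl S' = pgl S" "\<bar>det S'\<bar> = 1"
    and row: "0 < of_int (S'$1$1) * r + of_int (S'$1$2)" "0 < of_int (S'$2$1) * r + of_int (S'$2$2)"
    by blast
  \<comment> \<open>The precision that \<open>affine_pos_near\<close> asks for, the larger of the
    values for the two rows.\<close>
  define k where "k = Max ((\<lambda>i. (\<bar>of_int (S'$i$1)\<bar> + 1) /
    (of_int (S'$i$1) * r + of_int (S'$i$2))) ` UNIV)"
  have k_ge: "(\<bar>of_int (S'$i$1)\<bar> + 1) / (of_int (S'$i$1) * r + of_int (S'$i$2)) \<le> k" for i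
    unfolding k_def by (rule Max_ge) auto
  have "0 < (\<bar>real_of_int (S'$1$1)\<bar> + 1) / (of_int (S'$1$1) * r + of_int (S'$1$2))"
    using row by (intro divide_pos_pos) auto
  with k_ge[of 1] have k: "0 < k" by linarith
  have row': "0 < real_of_int (S'$i$1) * r + of_int (S'$i$2)" for i
    using row exhaust_2[of i] by auto
  show ?thesis
  proof (rule that)
    \<comment> \<open>By \<open>denominators_ge\<close> this length makes the product of the two
      denominators at least \<open>k\<close>.\<close>
    fix s assume "nat \<lceil>r + k\<rceil> \<le> s"
    then have s: "r + k \<le> real s" by linarith
    obtain x where x: "0 < x" "x \<notin> \<rat>" "r = act (wmat (LN_prefix r s)) x"
      "length (LN_prefix r s) = s" "set (LN_prefix r s) \<subseteq> {L, N}"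
      using LN_prefix_exists[OF r] by blast
    define w where "w = LN_prefix r s"
    note x = x[folded w_def]
    have d: "0 < real_of_int (wmat w $2$1)" "0 < real_of_int (wmat w $2$2)"
      "1 / (real_of_int (wmat w $2$1) * real_of_int (wmat w $2$2)) \<le> 1 / k"
      using LN_prefix_denominators[OF x(5,1,2) k] x(3,4) s by simp_all
    have near: "\<bar>of_int (wmat w $1$j) / of_int (wmat w $2$j) - r\<bar> \<le> 1 / k" for j
      using wmat_approximation[OF x(5,1) _ _ _ d(1,2), of 1 0]
        wmat_approximation[OF x(5,1) _ _ _ d(1,2), of 0 1] d(3) exhaust_2[of j] x(3)
      by (auto intro: order_trans)
    have "0 \<le> (S' ** wmat w) $i$j" for i j
    proof -
      have dj: "0 < real_of_int (wmat w $2$j)" using d exhaust_2[of j] by auto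
      have "0 < real_of_int (S'$i$1) * (of_int (wmat w $1$j) / of_int (wmat w $2$j)) + of_int (S'$i$2)"
        by (rule affine_pos_near[OF row' near k_ge])
      then have "0 < (of_int (S'$i$1) * (of_int (wmat w $1$j) / of_int (wmat w $2$j)) +
          of_int (S'$i$2)) * real_of_int (wmat w $2$j)"
        using dj by (rule mult_pos_pos)
      also have "\<dots> = of_int ((S' ** wmat w) $i$j)"
        using dj by (simp add: matrix_mult_entry field_simps)
      finally show ?thesis by simp
    qed
    moreover have "\<bar>det (S' ** wmat w)\<bar> = 1"
      using S' by (simp add: det_mul abs_mult)
    ultimately obtain v c where "set v \<subseteq> {L, N}" "S' ** wmat w = wmat v ** Fpow c"
      using nonneg_factorization by blast
    moreover have "pgl (S ** wmat w) = pgl (S' ** wmat w)"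
      using pgl_mult_right_cong[OF S'(1)] by simp
    ultimately show "\<exists>v c. set v \<subseteq> {L, N} \<and>
        pgl (S ** wmat (LN_prefix r s)) = pgl (wmat v ** Fpow c)"
      unfolding w_def by metis
  qed
qed

text \<open>Endpoints are rational or infinite. Hence the partition, whose intervals are disjoint
  only in their interiors, separates irrational points.\<close>

lemma irrational_in_interior:
  assumes "unimodular_interval I" "ereal r \<in> I" "r \<notin> \<rat>"
  shows "ereal r \<in> interior I"
proof -
  obtain p q p' q' where I: "I = {frac_point p q .. frac_point p' q'}"
    using assms(1) by (auto simp: unimodular_interval_def)
  have "ereal r \<noteq> frac_point k l" "frac_point k l \<noteq> ereal r" for k l
    using assms(3) by (auto simp: frac_point_def)
  with assms(2) I have "ereal r \<in> {frac_point p q <..< frac_point p' q'}"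
    by (auto simp: less_le)
  moreover have "{frac_point p q <..< frac_point p' q'} \<subseteq> interior I"
    by (rule interior_maximal) (auto simp: I)
  ultimately show ?thesis by blast
qed

lemma inv_moebius:
  assumes "\<bar>det M\<bar> = 1" "x \<noteq> - \<infinity>"
  shows "pgl_act (inv\<^bsub>PGL2Z\<^esub> (pgl M)) (moebius M x) = x"
    "moebius M (pgl_act (inv\<^bsub>PGL2Z\<^esub> (pgl M)) x) = x"
proof -
  have inv: "inv\<^bsub>PGL2Z\<^esub> (pgl M) = pgl (inv\<^bsub>GL2Z\<^esub> M)"
    using pgl.hom_inv[of M] assms by simp
  have nz: "det M \<noteq> 0" "det (inv\<^bsub>GL2Z\<^esub> M) \<noteq> 0"
    using assms(1) det_inv_GL2Z[OF assms(1)] by auto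
  show "pgl_act (inv\<^bsub>PGL2Z\<^esub> (pgl M)) (moebius M x) = x"
    unfolding inv pgl_act_pgl moebius_mult[OF nz(2,1) assms(2), symmetric]
    by (simp add: inv_GL2Z_mult moebius_one assms)
  show "moebius M (pgl_act (inv\<^bsub>PGL2Z\<^esub> (pgl M)) x) = x"
    unfolding inv pgl_act_pgl moebius_mult[OF nz assms(2), symmetric]
    by (simp add: inv_GL2Z_mult moebius_one assms)
qed

lemma branch_intervalE:
  assumes "\<bar>det M\<bar> = 1" "x \<in> branch_interval M"
  shows "pgl_act (inv\<^bsub>PGL2Z\<^esub> (pgl M)) x \<in> {0..\<infinity>}"
    "x = moebius M (pgl_act (inv\<^bsub>PGL2Z\<^esub> (pgl M)) x)"
proof -
  obtain z where z: "z \<in> {0..\<infinity>}" "x = moebius M z"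
    using assms(2) by (auto simp: branch_interval_def pgl_act_pgl)
  then have "pgl_act (inv\<^bsub>PGL2Z\<^esub> (pgl M)) x = z"
    using inv_moebius(1)[OF assms(1), of z] by auto
  with z show "pgl_act (inv\<^bsub>PGL2Z\<^esub> (pgl M)) x \<in> {0..\<infinity>}"
    "x = moebius M (pgl_act (inv\<^bsub>PGL2Z\<^esub> (pgl M)) x)" by simp_all
qed

lemma act_in_branch_interval:
  assumes "\<bar>det M\<bar> = 1" "0 < r" "r \<notin> \<rat>"
  shows "ereal (act M r) \<in> branch_interval M"
  using assms by (auto simp: branch_interval_def pgl_act_pgl moebius_ereal[symmetric])

lemma inv_pgl_act_ereal:
  assumes "\<bar>det M\<bar> = 1" "r \<notin> \<rat>"
  shows "pgl_act (inv\<^bsub>PGL2Z\<^esub> (pgl M)) (ereal r) = ereal (act (inv\<^bsub>GL2Z\<^esub> M) r)"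
proof -
  have inv: "inv\<^bsub>PGL2Z\<^esub> (pgl M) = pgl (inv\<^bsub>GL2Z\<^esub> M)"
    using pgl.hom_inv[of M] assms by simp
  show ?thesis
    unfolding inv pgl_act_pgl using assms by (simp add: moebius_ereal det_inv_GL2Z)
qed

section \<open>Symbolic orbits of irrational numbers\<close>

locale slow_algorithm =
  fixes n :: nat and A :: "nat \<Rightarrow> int^2^2"
  assumes slow_cf: "slow_cf n A"
begin

abbreviation B :: "nat \<Rightarrow> gen list" where "B a \<equiv> B_word (A a)"

abbreviation e :: "nat \<Rightarrow> bool" where "e a \<equiv> e_exp (A a)"

lemma n_ge_2: "2 \<le> n"
  using slow_cf by (simp add: slow_cf_def)

lemma det_A [simp]: "a < n \<Longrightarrow> \<bar>det (A a)\<bar> = 1"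
  using slow_cf by (simp add: slow_cf_def)

lemma A_nonneg: "a < n \<Longrightarrow> 0 \<le> A a $ i $ j"
  using slow_cf by (simp add: slow_cf_def)

lemma B_LN: "a < n \<Longrightarrow> set (B a) \<subseteq> {L, N}"
  by (rule LN_factor) (simp_all add: A_nonneg)

lemma A_eq: "a < n \<Longrightarrow> A a = wmat (B a) ** Fpow (e a)"
  by (rule LN_factor) (simp_all add: A_nonneg)

lemma act_A:
  assumes "a < n" "r \<notin> \<rat>"
  shows "act (A a) r = act (wmat (B a)) (act (Fpow (e a)) r)"
proof -
  have "act (wmat (B a) ** Fpow (e a)) r = act (wmat (B a)) (act (Fpow (e a)) r)"
    using assms by (simp add: act_mult)
  then show ?thesis
    using assms(1) by (simp flip: A_eq)
qed

lemma act_A_inj: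
  assumes "a < n" "b < n" "0 < x" "x \<notin> \<rat>" "0 < y" "y \<notin> \<rat>" "act (A a) x = act (A b) y"
  shows "a = b \<and> x = y"
proof -
  have "ereal (act (A a) x) \<in> interior (branch_interval (A a)) \<inter> interior (branch_interval (A b))"
  proof
    have U: "unimodular_interval (branch_interval (A c))" if "c < n" for c
      using slow_cf that by (simp add: slow_cf_def unimodular_partition_def)
    show "ereal (act (A a) x) \<in> interior (branch_interval (A a))"
      using assms by (intro irrational_in_interior U act_in_branch_interval) auto
    show "ereal (act (A a) x) \<in> interior (branch_interval (A b))"
      unfolding assms(7)
      using assms by (intro irrational_in_interior U act_in_branch_interval) auto
  qed
  then have "a = b"
    using slow_cf assms(1,2) unfolding slow_cf_def unimodular_partition_def by blast
  with assms show ?thesis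
    using act_inj[of "A a" x y] by simp
qed

text \<open>If \<open>B b\<close> extends \<open>B a\<close>, the interval of \<open>b\<close> lies
  inside that of \<open>a\<close>; one irrational point in both is enough for
  \<open>act_A_inj\<close>.\<close>

lemma B_prefix_free:
  assumes "a < n" "b < n" "prefix (B a) (B b)"
  shows "a = b"
proof -
  obtain z where z: "B b = B a @ z"
    using assms(3) by (rule prefixE)
  obtain x :: real where x: "0 < x" "x \<notin> \<rat>"
    by (rule irrational_exists)
  \<comment> \<open>The power of \<open>F\<close> undoes the one in \<open>A a\<close>, so that
    \<open>A a\<close> sends \<open>y\<close> to the same point as the word \<open>B b\<close> sends
    \<open>x\<close>.\<close>
  define y where "y = act (Fpow (e a)) (act (wmat z) x)"
  have y: "0 < y" "y \<notin> \<rat>"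
    using x by (simp_all add: y_def act_wmat_pos act_Fpow_pos)
  define x' where "x' = act (Fpow (e b)) x"
  have x': "0 < x'" "x' \<notin> \<rat>"
    using x by (simp_all add: x'_def act_Fpow_pos)
  have "act (A a) y = act (wmat (B a)) (act (wmat z) x)"
    using assms(1) y x by (simp add: act_A y_def act_Fpow_Fpow)
  also have "\<dots> = act (wmat (B b)) x"
    using x by (simp add: z wmat_append act_mult)
  also have "\<dots> = act (A b) x'"
    using assms(2) x x' by (simp add: act_A x'_def act_Fpow_Fpow)
  finally show ?thesis
    using act_A_inj[OF assms(1,2) y x'] by blast
qed

text \<open>An empty word would be a prefix of every other one, and \<open>2 \<le> n\<close>
  supplies another branch. Nonemptiness makes each branch advance along the word.\<close>

lemma B_nonempty:
  assumes "a < n"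
  shows "B a \<noteq> []"
proof
  assume "B a = []"
  moreover define b :: nat where "b = (if a = 0 then 1 else 0)"
  then have "b < n" "b \<noteq> a"
    using n_ge_2 by auto
  ultimately show False
    using B_prefix_free[of a b] assms by simp
qed

text \<open>Each point is written as the image of its successor, so that the orbit unrolls into the
  products \<open>branch_product\<close> without inverses.\<close>

definition real_orbit :: "(nat \<Rightarrow> nat) \<Rightarrow> (nat \<Rightarrow> real) \<Rightarrow> bool" where
  "real_orbit a y \<longleftrightarrow>
    (\<forall>t. a t < n \<and> 0 < y t \<and> y t \<notin> \<rat> \<and> y t = act (A (a t)) (y (Suc t)))"

lemma real_orbitD:
  assumes "real_orbit a y"
  shows "a t < n" "0 < y t" "y t \<notin> \<rat>" "y t = act (A (a t)) (y (Suc t))"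
  using assms unfolding real_orbit_def by blast+

lemma real_orbit_shift: "real_orbit a y \<Longrightarrow> real_orbit (\<lambda>l. a (h + l)) (\<lambda>l. y (h + l))"
  unfolding real_orbit_def add_Suc_right by blast

lemma symbolic_orbit_imp_real_orbit:
  assumes "symbolic_orbit n A a (ereal r)" "0 < r" "r \<notin> \<rat>"
  obtains y where "real_orbit a y" "y 0 = r"
proof -
  obtain x where x: "x 0 = ereal r" "\<And>t. a t < n" "\<And>t. x t \<in> branch_interval (A (a t))"
    "\<And>t. x (Suc t) = pgl_act (inv\<^bsub>PGL2Z\<^esub> (pgl (A (a t)))) (x t)"
    using assms(1) unfolding symbolic_orbit_def by blast
  define y where "y t = real_of_ereal (x t)" for t
  have step: "x (Suc t) = ereal (y (Suc t)) \<and> 0 < y (Suc t) \<and> y (Suc t) \<notin> \<rat> \<and>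
      y t = act (A (a t)) (y (Suc t))"
    if "x t = ereal (y t)" "y t \<notin> \<rat>" for t
  proof -
    define z where "z = act (inv\<^bsub>GL2Z\<^esub> (A (a t))) (y t)"
    have z: "x (Suc t) = ereal z"
      using x(2)[of t] that by (simp add: x(4) z_def inv_pgl_act_ereal)
    have "z \<notin> \<rat>"
      using x(2)[of t] that by (simp add: z_def det_inv_GL2Z)
    moreover have "0 \<le> z"
      using branch_intervalE(1)[OF _ x(3), of t] x(2)[of t] z by (simp flip: x(4))
    moreover from \<open>z \<notin> \<rat>\<close> have "z \<noteq> 0"
      by auto
    moreover have "y t = act (A (a t)) z"
      using x(2)[of t] that by (simp add: z_def act_inv)
    moreover have "y (Suc t) = z"
      by (simp add: y_def z)
    ultimately show ?thesis
      using z by simp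
  qed
  have "x t = ereal (y t) \<and> 0 < y t \<and> y t \<notin> \<rat>" for t
  proof (induction t)
    case 0
    then show ?case using assms by (simp add: x(1) y_def)
  next
    case (Suc t)
    then show ?case using step by blast
  qed
  then have "real_orbit a y"
    using step x(2) unfolding real_orbit_def by blast
  moreover have "y 0 = r"
    by (simp add: y_def x(1))
  ultimately show ?thesis using that by blast
qed

lemma real_orbit_imp_symbolic_orbit:
  assumes "real_orbit a y"
  shows "symbolic_orbit n A a (ereal (y 0))"
  unfolding symbolic_orbit_def
proof (intro exI[of _ "\<lambda>t. ereal (y t)"] conjI allI)
  fix t
  note o = real_orbitD[OF assms, of t] real_orbitD[OF assms, of "Suc t"]
  show "a t < n" by (rule o)
  show "ereal (y t) \<in> branch_interval (A (a t))"
    using act_in_branch_interval[of "A (a t)" "y (Suc t)"] o(1) o(6,7) by (simp flip: o(4))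
  show "ereal (y (Suc t)) = pgl_act (inv\<^bsub>PGL2Z\<^esub> (pgl (A (a t)))) (ereal (y t))"
    using o(1,3,7) by (subst o(4)) (simp add: inv_pgl_act_ereal act_inv)
qed simp

primrec branch_product :: "(nat \<Rightarrow> nat) \<Rightarrow> nat \<Rightarrow> int^2^2" where
  "branch_product a 0 = mat 1"
| "branch_product a (Suc t) = branch_product a t ** A (a t)"

lemma det_branch_product [simp]:
  assumes "\<And>t. a t < n"
  shows "\<bar>det (branch_product a t)\<bar> = 1"
  by (induction t) (simp_all add: det_mul abs_mult assms)

text \<open>The factors \<open>F\<close> are pushed to the right, twisting the words they cross. The
  length bound comes from \<open>B_nonempty\<close>; it drives both the convergence and the search
  for a visit.\<close>

lemma branch_product_factor:
  assumes "\<And>t. a t < n"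
  shows "\<exists>w c. set w \<subseteq> {L, N} \<and> t \<le> length w \<and> branch_product a t = wmat w ** Fpow c"
proof (induction t)
  case 0
  then show ?case
    by (intro exI[of _ "[]"] exI[of _ False]) (simp add: Fpow_def)
next
  case (Suc t)
  then obtain w c where w: "set w \<subseteq> {L, N}" "t \<le> length w" "branch_product a t = wmat w ** Fpow c"
    by blast
  let ?w = "w @ twist c (B (a t))"
  have "branch_product a (Suc t) = wmat w ** (Fpow c ** wmat (B (a t))) ** Fpow (e (a t))"
    using w(3) by (simp add: assms flip: matrix_mul_assoc A_eq)
  also have "\<dots> = wmat ?w ** Fpow (c \<noteq> e (a t))"
    by (simp only: Fpow_wmat wmat_append Fpow_mult[symmetric] matrix_mul_assoc)
  finally have "branch_product a (Suc t) = wmat ?w ** Fpow (c \<noteq> e (a t))" .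
  moreover have "set ?w \<subseteq> {L, N}"
    using w(1) B_LN[OF assms, of t] set_twist[of c "B (a t)"] by auto
  moreover have "Suc t \<le> length ?w"
    using w(2) B_nonempty[OF assms, of t] by (cases "B (a t)") auto
  ultimately show ?case by blast
qed

lemma real_orbit_act:
  assumes "real_orbit a y"
  shows "y 0 = act (branch_product a t) (y t)"
proof (induction t)
  case (Suc t)
  note o = real_orbitD[OF assms]
  show ?case
    using o(1) o(3) by (simp add: act_mult flip: Suc o(4))
qed simp

text \<open>\<open>sigma\<close> describes a point among all extended reals, so rational and
  infinite candidates have to be excluded too. Any candidate lies, together with \<open>y 0\<close>,
  in the image of \<open>[0, \<infinity>]\<close> under every branch product, and these images
  shrink to a point.\<close>

lemma symbolic_orbit_unique:
  assumes "real_orbit a y" "symbolic_orbit n A a \<alpha>"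
  shows "\<alpha> = ereal (y 0)"
proof -
  note o = real_orbitD[OF assms(1)]
  obtain x where x: "x 0 = \<alpha>" "\<And>t. x t \<in> branch_interval (A (a t))"
    "\<And>t. x (Suc t) = pgl_act (inv\<^bsub>PGL2Z\<^esub> (pgl (A (a t)))) (x t)"
    using assms(2) unfolding symbolic_orbit_def by blast
  have range: "x (Suc t) \<in> {0..\<infinity>}" and step: "x t = moebius (A (a t)) (x (Suc t))" for t
    using branch_intervalE[OF det_A[OF o(1)] x(2), of t] by (simp_all flip: x(3))
  \<comment> \<open>The product has at least one factor because only the points
    \<open>x (Suc t)\<close> have been placed in \<open>[0, \<infinity>]\<close>.\<close>
  have prod: "\<alpha> = moebius (branch_product a (Suc t)) (x (Suc t))" for t
  proof (induction t)
    case 0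
    show ?case using step[of 0] x(1) by simp
  next
    case (Suc t)
    have "x (Suc (Suc t)) \<noteq> - \<infinity>" using range[of "Suc t"] by auto
    moreover have "det (branch_product a (Suc t)) \<noteq> 0" "det (A (a (Suc t))) \<noteq> 0"
      using det_branch_product[of a "Suc t"] det_A[of "a (Suc t)"] o(1) by fastforce+
    ultimately have "moebius (branch_product a (Suc t) ** A (a (Suc t))) (x (Suc (Suc t))) =
        moebius (branch_product a (Suc t)) (x (Suc t))"
      by (simp add: moebius_mult step[of "Suc t", symmetric] del: branch_product.simps)
    with Suc show ?case by simp
  qed
  have near: "\<exists>s. \<alpha> = ereal s \<and> \<bar>s - y 0\<bar> \<le> 1 / k" if "0 < k" for k
  proof -
    \<comment> \<open>So many branches yield a word of length at least \<open>y 0 + k\<close>, whose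
      image of \<open>[0, \<infinity>]\<close> has length at most \<open>1/k\<close>.\<close>
    define t where "t = nat \<lceil>y 0 + k\<rceil>"
    obtain w c where w: "set w \<subseteq> {L, N}" "Suc t \<le> length w"
      "branch_product a (Suc t) = wmat w ** Fpow c"
      using branch_product_factor[of a "Suc t"] o(1) by blast
    define r where "r = act (Fpow c) (y (Suc t))"
    have r: "0 < r" "r \<notin> \<rat>" "y 0 = act (wmat w) r"
      using o(2,3) real_orbit_act[OF assms(1), of "Suc t"]
      by (simp_all add: r_def w(3) act_Fpow_pos act_mult del: branch_product.simps)
    have "y 0 + k \<le> real (length w)"
      using w(2) unfolding t_def by linarith
    then have d: "0 < real_of_int (wmat w $2$1)" "0 < real_of_int (wmat w $2$2)"
      "1 / (real_of_int (wmat w $2$1) * real_of_int (wmat w $2$2)) \<le> 1 / k"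
      using LN_prefix_denominators[OF w(1) r(1,2) that] r(3) by simp_all
    obtain u v where uv: "homog u v (x (Suc t))" "0 \<le> u" "0 \<le> v"
      using homog_nonneg[OF range] by blast
    have nz: "det (Fpow c) \<noteq> 0" "det (wmat w) \<noteq> 0"
      using det_Fpow[of c] det_wmat[of w] by (metis abs_zero zero_neq_one)+
    then have "det (wmat w ** Fpow c) \<noteq> 0"
      by (simp add: det_mul)
    define u' v' where "u' = of_int (Fpow c $1$1) * u + of_int (Fpow c $1$2) * v"
      and "v' = of_int (Fpow c $2$1) * u + of_int (Fpow c $2$2) * v"
    have uv': "0 \<le> u'" "0 \<le> v'"
      using uv Fpow_nonneg by (simp_all add: u'_def v'_def)
    have h: "homog u' v' (moebius (Fpow c) (x (Suc t)))"
      unfolding u'_def v'_def using homog_moebius[OF nz(1) uv(1)] .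
    have "\<alpha> = moebius (wmat w) (moebius (Fpow c) (x (Suc t)))"
      using prod[of t] homog_not_MInf[OF uv(1)] nz
      by (simp add: w(3) moebius_mult del: branch_product.simps)
    with homog_moebius[OF nz(2) h] have \<alpha>: "homog (of_int (wmat w $1$1) * u' + of_int (wmat w $1$2) * v')
        (of_int (wmat w $2$1) * u' + of_int (wmat w $2$2) * v') \<alpha>"
      by simp
    have "(u', v') \<noteq> (0, 0)"
      using h by (simp add: homog_def)
    from wmat_approximation[OF w(1) r(1) uv' this d(1,2)]
    have "\<bar>(of_int (wmat w $1$1) * u' + of_int (wmat w $1$2) * v') /
        (of_int (wmat w $2$1) * u' + of_int (wmat w $2$2) * v') - y 0\<bar> \<le> 1 / k"
      using d(3) r(3) by simp
    moreover have "of_int (wmat w $2$1) * u' + of_int (wmat w $2$2) * v' \<noteq> 0"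
      using d(1,2) uv' \<open>(u', v') \<noteq> (0, 0)\<close>
      by (auto simp: add_nonneg_eq_0_iff)
    ultimately show ?thesis
      using \<alpha> by (simp add: homog_def)
  qed
  obtain s where s: "\<alpha> = ereal s"
    using near[of 1] by auto
  have "\<bar>s - y 0\<bar> \<le> 0 + \<epsilon>" if "0 < \<epsilon>" for \<epsilon>
    using near[of "1 / \<epsilon>"] that s by auto
  then have "\<bar>s - y 0\<bar> \<le> 0"
    by (rule field_le_epsilon)
  with s show ?thesis by simp
qed

lemma sigma_eq:
  assumes "real_orbit a y"
  shows "sigma n A a = ereal (y 0)"
  unfolding sigma_def
  using real_orbit_imp_symbolic_orbit[OF assms] symbolic_orbit_unique[OF assms]
  by (rule the_equality)

lemma A_sharp_iff: "a \<in> A_sharp n A \<longleftrightarrow> (\<exists>y. real_orbit a y)"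
proof
  assume "a \<in> A_sharp n A"
  then show "\<exists>y. real_orbit a y"
    unfolding A_sharp_def using symbolic_orbit_imp_real_orbit by blast
next
  assume "\<exists>y. real_orbit a y"
  then obtain y where "real_orbit a y" ..
  then show "a \<in> A_sharp n A"
    unfolding A_sharp_def
    using real_orbitD(2,3)[of a y 0] real_orbit_imp_symbolic_orbit by blast
qed

lemma real_orbit_unique:
  assumes "real_orbit a y" "real_orbit a y'"
  shows "y 0 = y' 0"
  using symbolic_orbit_unique[OF assms(1) real_orbit_imp_symbolic_orbit[OF assms(2)]] by simp

text \<open>\<open>act_A_inj\<close> recovers from a point both its branch and the next
  point.\<close>

lemma real_orbit_determined:
  assumes "real_orbit a y" "real_orbit b z" "y 0 = z 0"
  shows "a = b"
proof -
  note o = real_orbitD[OF assms(1)] and o' = real_orbitD[OF assms(2)]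
  have step: "a t = b t \<and> y (Suc t) = z (Suc t)" if "y t = z t" for t
    using act_A_inj[OF o(1) o'(1) o(2,3) o'(2,3), of t "Suc t" t "Suc t"] that o(4)[of t] o'(4)[of t]
    by simp
  have "y t = z t" for t
    by (induction t) (use assms(3) step in auto)
  with step show ?thesis by blast
qed

section \<open>Visits to the root\<close>

lemma Sigma_subgroup: "subgroup (Sigma_T n A) PGL2Z"
  unfolding Sigma_T_def by (rule PGL2Z.generate_is_subgroup) auto

lemma branch_product_Sigma:
  assumes "\<And>t. a t < n"
  shows "pgl (branch_product a t) \<in> Sigma_T n A"
proof (induction t)
  case 0
  have "pgl (mat 1) = \<one>\<^bsub>PGL2Z\<^esub>"
    using pgl.hom_one by simp
  then show ?case
    using subgroup.one_closed[OF Sigma_subgroup] by simp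
next
  case (Suc t)
  have "pgl (A (a t)) \<in> Sigma_T n A"
    unfolding Sigma_T_def using assms by (intro generate.incl) auto
  with Suc show ?case
    using subgroup.m_closed[OF Sigma_subgroup] assms by (simp add: pgl_mult)
qed

text \<open>
  At time \<open>s\<close> of the expansion of \<open>r\<close> the path of \<open>b\<close> is at the root, after \<open>t\<close> branches. The flag
  \<open>c\<close> tells that the labels \<open>L\<close> and \<open>N\<close> are exchanged between the two readings from there on.
\<close>

definition visit :: "real \<Rightarrow> int^2^2 \<Rightarrow> (nat \<Rightarrow> nat) \<Rightarrow> nat \<Rightarrow> nat \<Rightarrow> bool \<Rightarrow> bool" where
  "visit r S b s t c \<longleftrightarrow>
    pgl (S ** wmat (LN_prefix r s)) = pgl (branch_product b t ** Fpow c)"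

text \<open>Cancelling the branch product in two expressions for \<open>z 0\<close> identifies the
  unread rest of \<open>r\<close> with the current point of the orbit of \<open>b\<close>, up to the
  twist.\<close>

lemma visit_point:
  assumes "0 < r" "r \<notin> \<rat>" "\<bar>det S\<bar> = 1" "real_orbit b z" "z 0 = act S r" "visit r S b s t c"
  shows "r = act (wmat (LN_prefix r s)) (act (Fpow c) (z t))"
proof -
  note o = real_orbitD[OF assms(4)]
  have det: "\<bar>det (branch_product b t)\<bar> = 1"
    using o(1) by simp
  obtain x where x: "0 < x" "x \<notin> \<rat>" "r = act (wmat (LN_prefix r s)) x"
    using LN_prefix_exists[OF assms(1,2)] by blast
  have "act (branch_product b t) (z t) = act (S ** wmat (LN_prefix r s)) x"
    using x real_orbit_act[OF assms(4), of t] assms(5) by (simp add: act_mult)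
  also have "\<dots> = act (branch_product b t ** Fpow c) x"
    using assms(6) unfolding visit_def by (rule act_pgl_cong)
  also have "\<dots> = act (branch_product b t) (act (Fpow c) x)"
    using x by (simp add: act_mult)
  finally have "z t = act (Fpow c) x"
    using act_inj[OF det o(3)] x(2) by simp
  then have "x = act (Fpow c) (z t)"
    using x(2) by (simp add: act_Fpow_Fpow)
  with x(3) show ?thesis by simp
qed

lemma LN_prefix_append:
  assumes "set (LN_prefix r s) \<subseteq> {L, N}" "length (LN_prefix r s) = s" "set v \<subseteq> {L, N}"
    "0 < y" "y \<notin> \<rat>" "r = act (wmat (LN_prefix r s)) (act (wmat v) y)"
  shows "LN_prefix r (s + length v) = LN_prefix r s @ v"
  using LN_prefix_eqI[of "LN_prefix r s @ v" y r] assms by (simp add: wmat_append act_mult)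

text \<open>By \<open>visit_point\<close> the rest of \<open>r\<close> begins with the word of the
  current branch, twisted by \<open>c\<close>. Crossing it, \<open>F^c\<close> restores
  \<open>B\<close>, and writing \<open>B\<close> as \<open>A F^e\<close> adds \<open>e\<close> to
  the twist.\<close>

lemma visit_next:
  assumes "0 < r" "r \<notin> \<rat>" "\<bar>det S\<bar> = 1" "real_orbit b z" "z 0 = act S r" "visit r S b s t c"
  shows "LN_prefix r (s + length (B (b t))) = LN_prefix r s @ twist c (B (b t))"
    "visit r S b (s + length (B (b t))) (Suc t) (c \<noteq> e (b t))"
proof -
  note o = real_orbitD[OF assms(4)]
  let ?w = "LN_prefix r s" and ?v = "twist c (B (b t))"
  have w: "set ?w \<subseteq> {L, N}" "length ?w = s"
    using LN_prefix_exists[OF assms(1,2), of s] by blast+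
  have "act (Fpow c) (z t) = act (wmat ?v) (act (Fpow c) (act (Fpow (e (b t))) (z (Suc t))))"
    using act_A[OF o(1) o(3), of t "Suc t"] o(4)[of t] o(3) by (simp add: act_Fpow_wmat)
  then have r: "r = act (wmat ?w) (act (wmat ?v) (act (Fpow c) (act (Fpow (e (b t))) (z (Suc t)))))"
    using visit_point[OF assms] by metis
  show *: "LN_prefix r (s + length (B (b t))) = ?w @ ?v"
  proof -
    have "set ?v \<subseteq> {L, N}"
      using B_LN[OF o(1), of t] by simp
    moreover have "0 < act (Fpow c) (act (Fpow (e (b t))) (z (Suc t)))"
      "act (Fpow c) (act (Fpow (e (b t))) (z (Suc t))) \<notin> \<rat>"
      using o(2,3) by (simp_all add: act_Fpow_pos)
    ultimately show ?thesis
      using LN_prefix_append[OF w _ _ _ r] unfolding length_twist by blast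
  qed
  have "pgl (S ** wmat (?w @ ?v)) = pgl (branch_product b t ** Fpow c ** wmat ?v)"
    using pgl_mult_right_cong[OF assms(6)[unfolded visit_def], of "wmat ?v"]
    by (simp only: wmat_append matrix_mul_assoc)
  also have "Fpow c ** wmat ?v = wmat (B (b t)) ** Fpow c"
    by (simp only: Fpow_wmat twist_twist)
  then have "branch_product b t ** Fpow c ** wmat ?v =
      branch_product b t ** (wmat (B (b t)) ** Fpow c)"
    by (simp flip: matrix_mul_assoc)
  also have "wmat (B (b t)) ** Fpow c = A (b t) ** Fpow (c \<noteq> e (b t))"
  proof -
    have "A (b t) ** Fpow (c \<noteq> e (b t)) =
        wmat (B (b t)) ** (Fpow (e (b t)) ** Fpow (c \<noteq> e (b t)))"
      using A_eq[OF o(1), of t] by (metis matrix_mul_assoc)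
    also have "Fpow (e (b t)) ** Fpow (c \<noteq> e (b t)) = Fpow c"
      unfolding Fpow_mult by (rule arg_cong[of _ _ Fpow]) blast
    finally show ?thesis ..
  qed
  finally show "visit r S b (s + length (B (b t))) (Suc t) (c \<noteq> e (b t))"
    unfolding visit_def * by (simp add: matrix_mul_assoc)
qed

text \<open>Some prefix goes to \<open>w F^c\<close>, but \<open>w\<close> need not stop where a
  branch ends. A branch product with a word \<open>v\<close> at least as long also starts the word
  of \<open>z 0\<close>, so \<open>v\<close> extends \<open>w\<close>; reading the missing letters,
  twisted by \<open>c\<close>, leads to the root.\<close>

lemma visit_exists:
  assumes "0 < r" "r \<notin> \<rat>" "\<bar>det S\<bar> = 1" "real_orbit b z" "z 0 = act S r"
  shows "\<exists>s t c. visit r S b s t c"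
proof -
  note o = real_orbitD[OF assms(4)]
  have "0 < act S r" using o(2)[of 0] assms(5) by simp
  then obtain s where "\<exists>w c. set w \<subseteq> {L, N} \<and>
      pgl (S ** wmat (LN_prefix r s)) = pgl (wmat w ** Fpow c)"
    using LN_prefix_image[OF assms(3,1,2)] by (metis order_refl)
  then obtain w c where w: "set w \<subseteq> {L, N}"
    "pgl (S ** wmat (LN_prefix r s)) = pgl (wmat w ** Fpow c)"
    by blast
  obtain x where x: "0 < x" "x \<notin> \<rat>" "r = act (wmat (LN_prefix r s)) x"
    "length (LN_prefix r s) = s" "set (LN_prefix r s) \<subseteq> {L, N}"
    using LN_prefix_exists[OF assms(1,2)] by blast
  \<comment> \<open>Each branch contributes at least one letter, so this many branches cover
    \<open>w\<close>.\<close>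
  define t where "t = length w"
  obtain v d where v: "set v \<subseteq> {L, N}" "t \<le> length v" "branch_product b t = wmat v ** Fpow d"
    using branch_product_factor[of b t] o(1) by blast
  define y where "y = act (Fpow d) (z t)"
  have y: "0 < y" "y \<notin> \<rat>"
    using o(2,3) by (simp_all add: y_def act_Fpow_pos)
  obtain v1 v2 where v12: "v = v1 @ v2" "length v1 = length w"
    using v(2) by (metis append_take_drop_id length_take min.absorb2 t_def)
  have LN: "set v1 \<subseteq> {L, N}" "set v2 \<subseteq> {L, N}"
    using v(1) v12(1) by auto
  have "z 0 = act (S ** wmat (LN_prefix r s)) x"
    using assms(5) x by (simp add: act_mult)
  also have "\<dots> = act (wmat w ** Fpow c) x"
    using w(2) by (rule act_pgl_cong)
  finally have "z 0 = act (wmat w) (act (Fpow c) x)"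
    using x by (simp add: act_mult)
  moreover have "z 0 = act (wmat v1) (act (wmat v2) y)"
    using real_orbit_act[OF assms(4), of t] o(3) y
    by (simp add: v(3) v12(1) act_mult wmat_append y_def)
  ultimately have "w = v1 \<and> act (Fpow c) x = act (wmat v2) y"
    using LN_word_unique[of w v1 "act (Fpow c) x" "act (wmat v2) y"] v12(2) w(1) LN(1) x(1,2) y
    by (simp add: act_Fpow_pos act_wmat_pos)
  then have wv: "w = v1" "act (Fpow c) x = act (wmat v2) y"
    by blast+
  have "act (Fpow c) (act (Fpow c) x) = act (wmat (twist c v2)) (act (Fpow c) y)"
    unfolding wv(2) by (rule act_Fpow_wmat[OF y(2)])
  then have "x = act (wmat (twist c v2)) (act (Fpow c) y)"
    using x(2) by (simp add: act_Fpow_Fpow)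
  with x(3) have r: "r = act (wmat (LN_prefix r s)) (act (wmat (twist c v2)) (act (Fpow c) y))"
    by metis
  have *: "LN_prefix r (s + length v2) = LN_prefix r s @ twist c v2"
  proof -
    have "set (twist c v2) \<subseteq> {L, N}"
      using LN(2) by simp
    moreover have "0 < act (Fpow c) y" "act (Fpow c) y \<notin> \<rat>"
      using y by (simp_all add: act_Fpow_pos)
    ultimately show ?thesis
      using LN_prefix_append[OF x(5,4) _ _ _ r] unfolding length_twist by blast
  qed
  have "pgl (S ** wmat (LN_prefix r s @ twist c v2)) = pgl (wmat w ** Fpow c ** wmat (twist c v2))"
    using pgl_mult_right_cong[OF w(2), of "wmat (twist c v2)"]
    by (simp only: wmat_append matrix_mul_assoc)
  also have "wmat w ** Fpow c ** wmat (twist c v2) = wmat v ** Fpow c"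
    by (simp add: v12(1) wv(1) wmat_append Fpow_wmat flip: matrix_mul_assoc)
  also have "\<dots> = branch_product b t ** Fpow (c \<noteq> d)"
  proof -
    have "Fpow d ** Fpow (c \<noteq> d) = Fpow c"
      unfolding Fpow_mult by (rule arg_cong[of _ _ Fpow]) blast
    then show ?thesis by (simp add: v(3) flip: matrix_mul_assoc)
  qed
  finally have "visit r S b (s + length v2) t (c \<noteq> d)"
    unfolding visit_def * .
  then show ?thesis by blast
qed

text \<open>By \<open>visit_point\<close> both orbits are at the same point, the rest of
  \<open>r\<close> with the same twist removed; \<open>real_orbit_determined\<close> then gives
  equal tails.\<close>

lemma same_visit:
  assumes "0 < r" "r \<notin> \<rat>"
    and "\<bar>det S\<bar> = 1" "real_orbit b z" "z 0 = act S r" "visit r S b s t c"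
    and "\<bar>det S'\<bar> = 1" "real_orbit b' z'" "z' 0 = act S' r" "visit r S' b' s t' c"
  shows "b (t + l) = b' (t' + l)"
proof -
  have irr: "z t \<notin> \<rat>" "z' t' \<notin> \<rat>"
    by (rule real_orbitD(3)[OF assms(4)], rule real_orbitD(3)[OF assms(8)])
  have "act (wmat (LN_prefix r s)) (act (Fpow c) (z t)) =
      act (wmat (LN_prefix r s)) (act (Fpow c) (z' t'))"
    by (rule trans[OF visit_point[OF assms(1-6), symmetric] visit_point[OF assms(1,2,7-10)]])
  then have "act (Fpow c) (z t) = act (Fpow c) (z' t')"
    by (rule act_inj[OF det_wmat act_irrational[OF det_Fpow irr(1)] act_irrational[OF det_Fpow irr(2)]])
  then have "z t = z' t'"
    by (rule act_inj[OF det_Fpow irr])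
  have "(\<lambda>l. b (t + l)) = (\<lambda>l. b' (t' + l))"
    by (rule real_orbit_determined[OF real_orbit_shift[OF assms(4)] real_orbit_shift[OF assms(8)]])
      (simp add: \<open>z t = z' t'\<close>)
  from fun_cong[OF this, of l] show ?thesis .
qed

lemma common_branch:
  assumes r: "0 < r" "r \<notin> \<rat>" and C: "finite C" "C \<noteq> {}"
    and S: "\<And>b. b \<in> C \<Longrightarrow> \<bar>det (S b)\<bar> = 1" "\<And>b. b \<in> C \<Longrightarrow> pgl (S b) \<in> Sigma_T n A"
    and z: "\<And>b. b \<in> C \<Longrightarrow> real_orbit b (z b)" "\<And>b. b \<in> C \<Longrightarrow> z b 0 = act (S b) r"
    and inequiv: "\<And>b b' h k. b \<in> C \<Longrightarrow> b' \<in> C \<Longrightarrow> (\<And>l. b (h + l) = b' (k + l)) \<Longrightarrow> b = b'"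
  obtains a g where "a < n" "inj_on g C" "\<And>b. b \<in> C \<Longrightarrow> strict_prefix (fst (g b)) (B a)"
    "\<And>b. b \<in> C \<Longrightarrow> pgl (wmat (fst (g b)) ** Fpow (snd (g b))) \<in> Sigma_T n A"
proof -
  define visited where "visited b s \<longleftrightarrow> (\<exists>t c. visit r (S b) b s t c)" for b s
  have "\<exists>s. visited b s" if "b \<in> C" for b
    using visit_exists[OF r S(1) z] that unfolding visited_def by blast
  then obtain first where first: "\<And>b. b \<in> C \<Longrightarrow> visited b (first b)"
    by metis
  \<comment> \<open>\<open>first b\<close> is any visit of \<open>b\<close>. With this
    \<open>m\<close> every sequence has a visit up to time \<open>m\<close>, so
    \<open>latest\<close> is the maximum of a nonempty set.\<close>
  define m where "m = Max (first ` C)"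
  define latest where "latest b = Max {s. s \<le> m \<and> visited b s}" for b
  have fin: "finite {s. s \<le> m \<and> visited b s}" for b
    by (rule finite_subset[of _ "{..m}"]) auto
  have latest: "latest b \<le> m \<and> visited b (latest b)" if "b \<in> C" for b
  proof -
    have "first b \<in> {s. s \<le> m \<and> visited b s}"
      using first[OF that] C(1) that by (simp add: m_def)
    then have "latest b \<in> {s. s \<le> m \<and> visited b s}"
      unfolding latest_def using fin by (intro Max_in) auto
    then show ?thesis by simp
  qed
  have "\<forall>b\<in>C. \<exists>t c. visit r (S b) b (latest b) t c"
    using latest unfolding visited_def by blast
  then obtain T c where visit: "\<And>b. b \<in> C \<Longrightarrow> visit r (S b) b (latest b) (T b) (c b)"
    by metis
  obtain i where i: "i \<in> C" "\<And>b. b \<in> C \<Longrightarrow> latest i \<le> latest b"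
    using arg_min_if_finite[OF C, of latest] by (metis not_le)
  define a where "a = i (T i)"
  have a: "a < n"
    using real_orbitD(1)[OF z(1)[OF i(1)]] by (simp add: a_def)
  let ?p = "LN_prefix r (latest i)"
  note nxt = visit_next[OF r S(1)[OF i(1)] z[OF i(1)] visit[OF i(1)], folded a_def]
  have len_p: "length ?p = latest i"
    using LN_prefix_exists[OF r] by metis
  \<comment> \<open>The next visit of \<open>i\<close> comes at the end of the word
    \<open>B a\<close>; were it at most \<open>m\<close>, it would be later than
    \<open>latest i\<close>.\<close>
  have "m < latest i + length (B a)"
  proof (rule ccontr)
    assume "\<not> m < latest i + length (B a)"
    then have "latest i + length (B a) \<le> latest i"
      using nxt(2) fin unfolding latest_def[of i, symmetric]
      by (subst (2) latest_def) (intro Max_ge, auto simp: visited_def)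
    then show False
      using B_nonempty[OF a] by simp
  qed
  \<comment> \<open>What \<open>i\<close> has read of its current branch when \<open>b\<close> makes
    its last visit.\<close>
  define u where "u b = take (latest b - latest i) (B a)" for b
  have len_lt: "latest b - latest i < length (B a)" if "b \<in> C" for b
    using latest[OF that] i(2)[OF that] \<open>m < latest i + length (B a)\<close> by linarith
  then have len_u: "length (u b) = latest b - latest i" if "b \<in> C" for b
    using that by (simp add: u_def)
  have prefix: "LN_prefix r (latest b) = ?p @ twist (c i) (u b)" if "b \<in> C" for b
  proof -
    have "LN_prefix r (latest b) = take (latest b) (LN_prefix r (latest i + length (B a)))"
      using len_lt[OF that] by (intro LN_prefix_take[OF r]) linarith
    also have "\<dots> = ?p @ take (latest b - latest i) (twist (c i) (B a))"
      unfolding nxt(1) using i(2)[OF that] len_p by simp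
    also have "take (latest b - latest i) (twist (c i) (B a)) = twist (c i) (u b)"
      by (simp add: u_def twist_def take_map)
    finally show ?thesis .
  qed
  \<comment> \<open>At that time \<open>i\<close> stands at \<open>u F^(c i)\<close> and
    \<open>b\<close> is at the root with twist \<open>c b\<close>. Removing the latter twist gives
    the flag; this is the possible exchange with the \<open>F\<close>-twin.\<close>
  define g where "g b = (u b, c i \<noteq> c b)" for b
  \<comment> \<open>The length of \<open>u b\<close> recovers \<open>latest b\<close> and the flag
    recovers \<open>c b\<close>, so equal values mean a common visit.\<close>
  have "inj_on g C"
  proof (rule inj_onI)
    fix b b' assume b: "b \<in> C" "b' \<in> C" and "g b = g b'"
    then have "u b = u b'" "c b = c b'"
      by (auto simp: g_def)
    then have "latest b = latest b'"
      using len_u[OF b(1)] len_u[OF b(2)] i(2)[OF b(1)] i(2)[OF b(2)] by simp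
    then have "visit r (S b') b' (latest b) (T b') (c b)"
      using visit[OF b(2)] \<open>c b = c b'\<close> by simp
    from same_visit[OF r S(1)[OF b(1)] z[OF b(1)] visit[OF b(1)] S(1)[OF b(2)] z[OF b(2)] this]
    show "b = b'"
      by (rule inequiv[OF b])
  qed
  moreover have "strict_prefix (fst (g b)) (B a)" if "b \<in> C" for b
    using len_lt[OF that] len_u[OF that]
    by (auto simp: g_def u_def strict_prefix_def take_is_prefix dest: arg_cong[of _ _ length])
  moreover have "pgl (wmat (fst (g b)) ** Fpow (snd (g b))) \<in> Sigma_T n A" if "b \<in> C" for b
  proof -
    have orbit: "\<And>t. i t < n" "\<And>t. b t < n"
      using real_orbitD(1)[OF z(1)] i(1) that by blast+
    have "pgl (S i ** wmat (LN_prefix r (latest b))) =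
        pgl (branch_product i (T i) ** Fpow (c i) ** wmat (twist (c i) (u b)))"
      using pgl_mult_right_cong[OF visit[OF i(1), unfolded visit_def], of "wmat (twist (c i) (u b))"]
      unfolding prefix[OF that] wmat_append matrix_mul_assoc .
    also have "branch_product i (T i) ** Fpow (c i) ** wmat (twist (c i) (u b)) =
        branch_product i (T i) ** (wmat (u b) ** Fpow (c i))"
      by (simp add: Fpow_wmat flip: matrix_mul_assoc)
    finally have eq: "pgl (S i ** wmat (LN_prefix r (latest b))) =
        pgl (branch_product i (T i) ** (wmat (u b) ** Fpow (c i)))" .
    have one: "pgl (Fpow (c b)) \<otimes>\<^bsub>PGL2Z\<^esub> pgl (Fpow (c b)) = \<one>\<^bsub>PGL2Z\<^esub>"
    proof -
      have "Fpow (c b) ** Fpow (c b) = mat 1"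
        by (simp add: Fpow_mult) (simp add: Fpow_def)
      then have "pgl (Fpow (c b)) \<otimes>\<^bsub>PGL2Z\<^esub> pgl (Fpow (c b)) = pgl (mat 1)"
        by (simp flip: pgl_mult)
      then show ?thesis
        using pgl.hom_one by simp
    qed
    have carrier: "pgl M \<in> carrier PGL2Z" if "\<bar>det M\<bar> = 1" for M
      using pgl.hom_closed that by simp
    have "pgl (wmat (u b)) \<otimes>\<^bsub>PGL2Z\<^esub> (pgl (Fpow (c i)) \<otimes>\<^bsub>PGL2Z\<^esub> pgl (Fpow (c b))) \<in> Sigma_T n A"
    proof (rule PGL2Z.subgroup_transfer[OF Sigma_subgroup S(2)[OF i(1)] S(2)[OF that]
          branch_product_Sigma branch_product_Sigma])
      show "pgl (S i) \<otimes>\<^bsub>PGL2Z\<^esub> pgl (wmat (LN_prefix r (latest b))) =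
          pgl (branch_product i (T i)) \<otimes>\<^bsub>PGL2Z\<^esub> (pgl (wmat (u b)) \<otimes>\<^bsub>PGL2Z\<^esub> pgl (Fpow (c i)))"
        using eq S(1)[OF i(1)] orbit by (simp add: pgl_mult det_mul abs_mult)
      show "pgl (S b) \<otimes>\<^bsub>PGL2Z\<^esub> pgl (wmat (LN_prefix r (latest b))) =
          pgl (branch_product b (T b)) \<otimes>\<^bsub>PGL2Z\<^esub> pgl (Fpow (c b))"
        using visit[OF that] S(1)[OF that] orbit by (simp add: visit_def pgl_mult)
    qed (use one carrier orbit in simp_all)
    then have "pgl (wmat (u b) ** (Fpow (c i) ** Fpow (c b))) \<in> Sigma_T n A"
      by (simp add: pgl_mult det_mul abs_mult)
    then show ?thesis
      by (simp add: g_def Fpow_mult)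
  qed
  ultimately show ?thesis
    using that[OF a] by blast
qed

end

section \<open>Primitive paths\<close>

text \<open>Fixing the end \<open>j\<close> and moving the start downwards matches the recursion of
  \<open>cas\<close> and \<open>awalk_verts\<close> on the first arc.\<close>

lemma lgraph_walk:
  fixes f :: "nat \<Rightarrow> 'v" and g :: "nat \<Rightarrow> gen"
  assumes "i \<le> j"
  defines "p \<equiv> \<lambda>i. map (\<lambda>k. (f k, g k, f (Suc k))) [i..<j]"
  shows "pre_digraph.cas (lgraph V E) (f i) (p i) (f j) \<and>
    pre_digraph.awalk_verts (lgraph V E) (f i) (p i) = map f [i..<Suc j]"
  using assms(1)
proof (induction i rule: inc_induct)
  case base
  then show ?case
    by (simp add: p_def pre_digraph.cas.simps pre_digraph.awalk_verts.simps)
next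
  case (step i)
  have "p i = (f i, g i, f (Suc i)) # p (Suc i)"
    using step.hyps by (simp add: p_def upt_conv_Cons)
  moreover have "map f [i..<Suc j] = f i # map f [Suc i..<Suc j]"
    using step.hyps by (simp add: upt_conv_Cons del: upt_Suc)
  ultimately show ?case
    using step.IH
    by (simp add: pre_digraph.cas.simps pre_digraph.awalk_verts.simps lgraph_def del: upt_Suc)
qed

lemma awalk_verts_subset:
  "set (pre_digraph.awalk_verts G u p) \<subseteq> insert u (head G ` set p \<union> tail G ` set p)"
  by (induction p arbitrary: u) (auto simp: pre_digraph.awalk_verts.simps)

context slow_algorithm
begin

lemma finite_left_factors: "finite (left_factors n A)"
proof -
  have "left_factors n A = (\<Union>a<n. set (prefixes (B a)))"
    by (auto simp: left_factors_def)
  then show ?thesis by simp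
qed

lemma finite_arcs_graph_T: "finite (arcs (graph_T n A))"
proof -
  have "w \<in> left_factors n A" if "w @ [g] \<in> left_factors n A" for w g
    using that by (auto simp: left_factors_def dest: append_prefixD)
  then have "tree_edges n A \<subseteq>
      (left_factors n A \<times> UNIV) \<times> {L, N, F} \<times> (left_factors n A \<times> UNIV)"
    by (auto simp: tree_edges_def)
  then have "finite (tree_edges n A)"
    by (rule finite_subset) (simp add: finite_left_factors)
  then show ?thesis
    by (simp add: graph_T_def lgraph_def)
qed

text \<open>Comparing cardinalities by inclusion requires a finite set. The union runs over paths of
  any length, but apart from the two roots their vertices are ends of finitely many arcs.\<close>

lemma finite_D_set: "finite (D_set n A a)"
proof -
  let ?G = "graph_T n A"
  have "D_set n A a \<subseteq> {vertex1, vertex2} \<union> (head ?G ` arcs ?G \<union> tail ?G ` arcs ?G)"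
  proof -
    have "set (pre_digraph.awalk_verts ?G i p) \<subseteq>
        {vertex1, vertex2} \<union> (head ?G ` arcs ?G \<union> tail ?G ` arcs ?G)"
      if "primitive_path n A i p j" for i p j
    proof -
      have "i \<in> {vertex1, vertex2}" "set p \<subseteq> arcs ?G"
        using that by (auto simp: primitive_path_def pre_digraph.awalk_def)
      then show ?thesis
        using awalk_verts_subset[of ?G i p] by blast
    qed
    then show ?thesis
      unfolding D_set_def by blast
  qed
  then show ?thesis
    by (rule finite_subset) (simp add: finite_arcs_graph_T)
qed

text \<open>Prefix-freeness keeps the inner vertices of the tree apart from the leaves.\<close>

lemma glue_strict_prefix:
  assumes "a < n" "strict_prefix w (B a)"
  shows "glue n A (w, c) = (w, c)"
proof -
  have "w \<noteq> B b" if "b < n" for b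
    using B_prefix_free[OF that assms(1)] assms(2) by (auto simp: strict_prefix_def)
  then have "\<not> (\<exists>b<n. w = B b)" by blast
  then show ?thesis by (simp only: glue_def case_prod_conv if_False)
qed

lemma glue_leaf:
  assumes "a < n"
  shows "glue n A (B a, c) = ([], c \<noteq> e a)"
proof -
  have "(THE b. b < n \<and> B a = B b) = a"
    using assms B_prefix_free by (intro the_equality) auto
  with assms show ?thesis
    by (auto simp: glue_def vertex1_def vertex2_def)
qed

text \<open>Descending along \<open>B a\<close> in the copy \<open>d\<close> gives one of the two
  \<open>F\<close>-twin paths of \<open>A a\<close>: its labels spell \<open>twist d (B a)\<close>,
  and the factors \<open>F\<close> from its two ends restore \<open>A a\<close>.\<close>

lemma strict_prefix_in_D_set:
  assumes a: "a < n" and w: "strict_prefix w (B a)"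
  shows "(w, d) \<in> D_set n A a"
proof -
  let ?G = "graph_T n A" and ?m = "length (B a)"
  \<comment> \<open>Along the path \<open>glue\<close> changes only the vertex at
    \<open>k = ?m\<close>, where the leaf becomes a root.\<close>
  define f where "f k = glue n A (take k (B a), d)" for k
  define p where "p = map (\<lambda>k. (f k, if d then twin_label (B a ! k) else B a ! k, f (Suc k))) [0..<?m]"
  have B: "B a \<noteq> []" "set (B a) \<subseteq> {L, N}"
    using B_nonempty[OF a] B_LN[OF a] by auto
  have f: "f k = (take k (B a), d)" if "k < ?m" for k
    unfolding f_def by (rule glue_strict_prefix[OF a])
      (use that in \<open>auto simp: strict_prefix_def take_is_prefix dest: arg_cong[of _ _ length]\<close>)
  have f0: "f 0 = ([], d)"
    using f[of 0] B(1) by simp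
  have fm: "f ?m = ([], d \<noteq> e a)"
    using glue_leaf[OF a] by (simp add: f_def)
  have LF: "take k (B a) \<in> left_factors n A" for k
    using a by (auto simp: left_factors_def take_is_prefix)
  have walk: "pre_digraph.cas ?G (f 0) p (f ?m)"
    "pre_digraph.awalk_verts ?G (f 0) p = map f [0..<Suc ?m]"
    using lgraph_walk[where f = f and g = "\<lambda>k. if d then twin_label (B a ! k) else B a ! k", OF le0]
    unfolding p_def graph_T_def by blast+
  have arc: "(f k, if d then twin_label (B a ! k) else B a ! k, f (Suc k)) \<in> arcs ?G"
    if "k < ?m" for k
  proof -
    have "take (Suc k) (B a) = take k (B a) @ [B a ! k]"
      using that by (rule take_Suc_conv_app_nth)
    moreover have "B a ! k \<in> {L, N}"
      using B(2) nth_mem[OF that] by blast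
    ultimately have "((take k (B a), d), if d then twin_label (B a ! k) else B a ! k,
        (take (Suc k) (B a), d)) \<in> tree_edges n A"
      using LF[of "Suc k"] unfolding tree_edges_def by auto
    then show ?thesis
      unfolding graph_T_def lgraph_def f_def by (auto intro!: rev_image_eqI)
  qed
  have labels: "map arc_label p = twist d (B a)"
    by (rule nth_equalityI) (simp_all add: p_def arc_label_def twist_def)
  have "primitive_path n A (f 0) p (f ?m)"
    unfolding primitive_path_def
  proof (intro conjI)
    show "f 0 \<in> {vertex1, vertex2}" "f ?m \<in> {vertex1, vertex2}"
      unfolding f0 fm vertex1_def vertex2_def by auto
    show "p \<noteq> []"
      using B(1) by (simp add: p_def)
    have "f 0 \<in> verts ?G"
      using LF[of 0] by (auto simp: graph_T_def lgraph_def f_def)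
    moreover have "set p \<subseteq> arcs ?G"
      using arc by (auto simp: p_def)
    ultimately show "pre_digraph.awalk ?G (f 0) p (f ?m)"
      using walk(1) by (simp add: pre_digraph.awalk_def)
    have "arc_label ` set p = set (twist d (B a))"
      by (simp flip: labels)
    then show "arc_label ` set p \<subseteq> {L, N}"
      using B(2) by simp
    have "tl (butlast (map f [0..<Suc ?m])) = map f [1..<?m]"
      by (simp add: map_tl[symmetric] tl_upt)
    moreover have "vertex1 \<noteq> f k" "vertex2 \<noteq> f k" if "k \<in> {1..<?m}" for k
      using that B(1) f[of k] by (auto simp: vertex1_def vertex2_def)
    ultimately show "set (tl (butlast (pre_digraph.awalk_verts ?G (f 0) p))) \<inter> {vertex1, vertex2} = {}"
      unfolding walk(2) by auto
  qed
  moreover have "path_value (f 0) p (f ?m) = pgl (A a)"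
  proof -
    have "Fpow d ** wmat (twist d (B a)) ** Fpow (d \<noteq> e a) =
        wmat (B a) ** (Fpow d ** Fpow (d \<noteq> e a))"
      by (simp only: Fpow_wmat twist_twist matrix_mul_assoc)
    also have "Fpow d ** Fpow (d \<noteq> e a) = Fpow (e a)"
      unfolding Fpow_mult by (rule arg_cong[of _ _ Fpow]) blast
    finally show ?thesis
      using A_eq[OF a] by (simp add: path_value_def labels f0 fm vertex2_def)
  qed
  moreover have "(w, d) \<in> set (pre_digraph.awalk_verts ?G (f 0) p)"
  proof -
    have "w = take (length w) (B a)" "length w < ?m"
      using w by (auto simp: strict_prefix_def prefix_def)
    then have "(w, d) = f (length w)" "length w \<in> set [0..<Suc ?m]"
      using f by auto
    then show ?thesis
      unfolding walk(2) by (metis imageI list.set_map)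
  qed
  ultimately show ?thesis
    unfolding D_set_def by blast
qed

lemma card_le_defect:
  assumes "a < n" "finite C" "inj_on g C"
    and g: "\<And>b. b \<in> C \<Longrightarrow> strict_prefix (fst (g b)) (B a)"
      "\<And>b. b \<in> C \<Longrightarrow> pgl (wmat (fst (g b)) ** Fpow (snd (g b))) \<in> Sigma_T n A"
  shows "card C \<le> defect n A"
proof -
  have "g b \<in> {v \<in> D_set n A a. phi n A v = Sigma_T n A}" if "b \<in> C" for b
  proof -
    have "g b \<in> D_set n A a"
      using strict_prefix_in_D_set[OF assms(1) g(1)[OF that], of "snd (g b)"] by simp
    moreover have "phi n A (g b) = Sigma_T n A"
      unfolding phi_def
      by (rule PGL2Z.coset_join2[OF _ Sigma_subgroup g(2)[OF that]])
        (use subgroup.mem_carrier[OF Sigma_subgroup g(2)[OF that]] in simp)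
    ultimately show ?thesis by simp
  qed
  then have "g ` C \<subseteq> {v \<in> D_set n A a. phi n A v = Sigma_T n A}"
    by blast
  then have "card C \<le> card {v \<in> D_set n A a. phi n A v = Sigma_T n A}"
    using card_inj_on_le[OF assms(3)] finite_D_set by simp
  also have "\<dots> \<le> defect n A"
    unfolding defect_def using assms(1) by (intro Max_ge) auto
  finally show ?thesis .
qed

section \<open>Tail-equivalence classes\<close>

lemma Sigma_equiv_iff:
  "(a, b) \<in> Sigma_equiv n A \<longleftrightarrow>
    (\<exists>y z S. real_orbit a y \<and> real_orbit b z \<and> \<bar>det S\<bar> = 1 \<and> pgl S \<in> Sigma_T n A \<and>
      z 0 = act S (y 0))"
proof
  assume ab: "(a, b) \<in> Sigma_equiv n A"
  then obtain y z X where yz: "real_orbit a y" "real_orbit b z"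
    and X: "X \<in> Sigma_T n A" "pgl_act X (sigma n A a) = sigma n A b"
    unfolding Sigma_equiv_def A_sharp_iff by blast
  obtain S where S: "\<bar>det S\<bar> = 1" "X = pgl S"
    using subgroup.mem_carrier[OF Sigma_subgroup X(1)] by (rule pgl_carrier_cases)
  have "z 0 = act S (y 0)"
    using X(2) S real_orbitD(3)[OF yz(1)]
    by (simp add: sigma_eq[OF yz(1)] sigma_eq[OF yz(2)] pgl_act_pgl moebius_ereal)
  with yz S X(1) show "\<exists>y z S. real_orbit a y \<and> real_orbit b z \<and> \<bar>det S\<bar> = 1 \<and>
      pgl S \<in> Sigma_T n A \<and> z 0 = act S (y 0)"
    by blast
next
  assume "\<exists>y z S. real_orbit a y \<and> real_orbit b z \<and> \<bar>det S\<bar> = 1 \<and> pgl S \<in> Sigma_T n A \<and>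
      z 0 = act S (y 0)"
  then obtain y z S where yz: "real_orbit a y" "real_orbit b z"
    and S: "\<bar>det S\<bar> = 1" "pgl S \<in> Sigma_T n A" "z 0 = act S (y 0)"
    by blast
  have "pgl_act (pgl S) (sigma n A a) = sigma n A b"
    using S real_orbitD(3)[OF yz(1)]
    by (simp add: sigma_eq[OF yz(1)] sigma_eq[OF yz(2)] pgl_act_pgl moebius_ereal)
  with yz S(2) show "(a, b) \<in> Sigma_equiv n A"
    unfolding Sigma_equiv_def A_sharp_iff by blast
qed

lemma Sigma_equiv_trans: "trans (Sigma_equiv n A)"
proof (rule transI)
  fix a b c
  assume "(a, b) \<in> Sigma_equiv n A" "(b, c) \<in> Sigma_equiv n A"
  then obtain y z z' x S S' where o: "real_orbit a y" "real_orbit b z" "real_orbit b z'" "real_orbit c x"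
    and S: "\<bar>det S\<bar> = 1" "pgl S \<in> Sigma_T n A" "z 0 = act S (y 0)"
    and S': "\<bar>det S'\<bar> = 1" "pgl S' \<in> Sigma_T n A" "x 0 = act S' (z' 0)"
    unfolding Sigma_equiv_iff by blast
  have "x 0 = act (S' ** S) (y 0)"
    using S S' real_orbitD(3)[OF o(1)] real_orbit_unique[OF o(2,3)] by (simp add: act_mult)
  moreover have "\<bar>det (S' ** S)\<bar> = 1"
    using S S' by (simp add: det_mul abs_mult)
  moreover have "pgl (S' ** S) \<in> Sigma_T n A"
    using S S' subgroup.m_closed[OF Sigma_subgroup] by (simp add: pgl_mult)
  ultimately show "(a, c) \<in> Sigma_equiv n A"
    using o unfolding Sigma_equiv_iff by blast
qed

text \<open>A common tail means \<open>y h = z k\<close>, because a sequence has only one point. The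
  branch products \<open>M\<close>, \<open>K\<close> of the two heads then give the matrix
  \<open>K M^-1\<close>, which carries \<open>y 0\<close> to \<open>z 0\<close>.\<close>

lemma tail_equiv_subset_Sigma_equiv: "tail_equiv n A \<subseteq> Sigma_equiv n A"
proof clarify
  fix a b assume "(a, b) \<in> tail_equiv n A"
  then obtain y z h k where o: "real_orbit a y" "real_orbit b z"
    and hk: "\<And>l. a (h + l) = b (k + l)"
    unfolding tail_equiv_def A_sharp_iff by blast
  have lt: "\<And>t. a t < n" "\<And>t. b t < n"
    using real_orbitD(1) o by blast+
  let ?M = "branch_product a h" and ?K = "branch_product b k"
  have "real_orbit (\<lambda>l. b (k + l)) (\<lambda>l. y (h + l))"
    using real_orbit_shift[OF o(1), of h] by (simp only: hk)
  from real_orbit_unique[OF this real_orbit_shift[OF o(2)]] have yz: "y h = z k"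
    by simp
  have "y h = act (inv\<^bsub>GL2Z\<^esub> ?M) (y 0)"
    unfolding real_orbit_act[OF o(1), of h] using lt real_orbitD(3)[OF o(1)] by (simp add: act_inv)
  then have "z 0 = act ?K (act (inv\<^bsub>GL2Z\<^esub> ?M) (y 0))"
    using real_orbit_act[OF o(2), of k] by (simp only: yz)
  also have "\<dots> = act (?K ** inv\<^bsub>GL2Z\<^esub> ?M) (y 0)"
    using lt real_orbitD(3)[OF o(1), of 0] by (simp add: act_mult det_inv_GL2Z)
  finally have "z 0 = act (?K ** inv\<^bsub>GL2Z\<^esub> ?M) (y 0)" .
  moreover have "\<bar>det (?K ** inv\<^bsub>GL2Z\<^esub> ?M)\<bar> = 1"
    using lt by (simp add: det_mul abs_mult det_inv_GL2Z)
  moreover have "pgl (?K ** inv\<^bsub>GL2Z\<^esub> ?M) \<in> Sigma_T n A"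
  proof -
    have "pgl (?K ** inv\<^bsub>GL2Z\<^esub> ?M) = pgl ?K \<otimes>\<^bsub>PGL2Z\<^esub> inv\<^bsub>PGL2Z\<^esub> (pgl ?M)"
      using lt pgl.hom_inv[of ?M] by (simp add: pgl_mult det_inv_GL2Z)
    then show ?thesis
      using branch_product_Sigma lt subgroup.m_closed[OF Sigma_subgroup]
        subgroup.m_inv_closed[OF Sigma_subgroup] by simp
  qed
  ultimately show "(a, b) \<in> Sigma_equiv n A"
    using o unfolding Sigma_equiv_iff by blast
qed

lemma equiv_tail_equiv: "equiv (A_sharp n A) (tail_equiv n A)"
proof (rule equivI)
  show "tail_equiv n A \<subseteq> A_sharp n A \<times> A_sharp n A"
    by (auto simp: tail_equiv_def)
  show "refl_on (A_sharp n A) (tail_equiv n A)"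
    by (auto simp: refl_on_def tail_equiv_def)
  show "sym (tail_equiv n A)"
    by (rule symI) (auto simp: tail_equiv_def, metis)
  show "trans (tail_equiv n A)"
  proof (rule transI)
    fix a b c assume ab: "(a, b) \<in> tail_equiv n A" and bc: "(b, c) \<in> tail_equiv n A"
    then obtain h k h' k' where hk: "\<And>l. a (h + l) = b (k + l)" "\<And>l. b (h' + l) = c (k' + l)"
      unfolding tail_equiv_def by blast
    have "a (h + h' + l) = c (k' + k + l)" for l
      using hk(1)[of "h' + l"] hk(2)[of "k + l"] by (simp add: algebra_simps)
    with ab bc show "(a, c) \<in> tail_equiv n A"
      unfolding tail_equiv_def by blast
  qed
qed

lemma tail_class_subset:
  assumes "x \<in> Sigma_equiv n A `` {a}"
  shows "tail_equiv n A `` {x} \<subseteq> Sigma_equiv n A `` {a}"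
  using assms tail_equiv_subset_Sigma_equiv Sigma_equiv_trans by (blast dest: transD)

text \<open>Tail classes of elements of \<open>?C\<close> stay in \<open>?C\<close>, so the quotient
  is the one by the restricted relation, an equivalence on \<open>?C\<close>.\<close>

lemma partition_tail_classes:
  "partition_on (Sigma_equiv n A `` {a}) ((Sigma_equiv n A `` {a}) // tail_equiv n A)"
proof -
  let ?C = "Sigma_equiv n A `` {a}" and ?R = "tail_equiv n A"
  note R = equiv_tail_equiv[unfolded equiv_def]
  have sub: "?C \<subseteq> A_sharp n A"
    by (auto simp: Sigma_equiv_def)
  have "equiv ?C (Restr ?R ?C)"
  proof (rule equivI)
    show "refl_on ?C (Restr ?R ?C)"
      using R sub by (auto simp: refl_on_def)
    show "sym (Restr ?R ?C)"
      using R by (auto intro!: symI dest: symD)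
    show "trans (Restr ?R ?C)"
      using R by (intro trans_Restr) blast
  qed auto
  moreover have "?R `` {x} = Restr ?R ?C `` {x}" if "x \<in> ?C" for x
    using tail_class_subset[OF that] that by blast
  then have "?C // ?R = ?C // Restr ?R ?C"
    unfolding quotient_def by (intro SUP_cong) simp_all
  ultimately show ?thesis
    using partition_on_quotient by metis
qed

text \<open>Stated for finite families, since the quotient is not yet known to be finite; the
  uniform bound yields its finiteness as well. \<open>common_branch\<close> is applied to one
  representative of each class.\<close>

lemma card_tail_classes_le:
  assumes G: "G \<subseteq> (Sigma_equiv n A `` {a}) // tail_equiv n A" "finite G"
  shows "card G \<le> defect n A"
proof (cases "G = {}")
  case False
  let ?C = "Sigma_equiv n A `` {a}" and ?R = "tail_equiv n A"
  have "\<forall>X\<in>G. \<exists>x\<in>?C. X = ?R `` {x}"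
    using G(1) by (blast elim: quotientE)
  then obtain f where f: "\<And>X. X \<in> G \<Longrightarrow> f X \<in> ?C" "\<And>X. X \<in> G \<Longrightarrow> X = ?R `` {f X}"
    by metis
  have inj: "inj_on f G"
    using f(2) by (metis inj_onI)
  have orbits: "\<forall>b\<in>f ` G. \<exists>y z S. real_orbit a y \<and> real_orbit b z \<and> \<bar>det S\<bar> = 1 \<and>
      pgl S \<in> Sigma_T n A \<and> z 0 = act S (y 0)"
    using f(1) unfolding Sigma_equiv_iff[symmetric] by blast
  with False obtain y where y: "real_orbit a y"
    by blast
  \<comment> \<open>Each equivalence brings its own orbit of \<open>a\<close>, but all of them start
    at the same point, so one \<open>y\<close> serves every \<open>b\<close>.\<close>
  have "\<exists>z S. real_orbit b z \<and> \<bar>det S\<bar> = 1 \<and> pgl S \<in> Sigma_T n A \<and> z 0 = act S (y 0)"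
    if "b \<in> f ` G" for b
    using orbits that real_orbit_unique[OF y] by metis
  then obtain z S where zS: "\<And>b. b \<in> f ` G \<Longrightarrow> real_orbit b (z b)"
    "\<And>b. b \<in> f ` G \<Longrightarrow> \<bar>det (S b)\<bar> = 1" "\<And>b. b \<in> f ` G \<Longrightarrow> pgl (S b) \<in> Sigma_T n A"
    "\<And>b. b \<in> f ` G \<Longrightarrow> z b 0 = act (S b) (y 0)"
    by metis
  have inequiv: "b = b'"
    if b: "b \<in> f ` G" "b' \<in> f ` G" and tail: "\<And>l. b (h + l) = b' (k + l)" for b b' h k
  proof -
    obtain X X' where X: "X \<in> G" "X' \<in> G" "b = f X" "b' = f X'"
      using b by blast
    have "b \<in> A_sharp n A" "b' \<in> A_sharp n A"
      using zS(1) b A_sharp_iff by blast+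
    with tail have "(b, b') \<in> ?R"
      unfolding tail_equiv_def by blast
    then have "?R `` {b} = ?R `` {b'}"
      by (rule equiv_class_eq[OF equiv_tail_equiv])
    then have "X = X'"
      using f(2) X by metis
    with X show ?thesis by simp
  qed
  obtain c g where c: "c < n" "inj_on g (f ` G)"
    "\<And>b. b \<in> f ` G \<Longrightarrow> strict_prefix (fst (g b)) (B c)"
    "\<And>b. b \<in> f ` G \<Longrightarrow> pgl (wmat (fst (g b)) ** Fpow (snd (g b))) \<in> Sigma_T n A"
  proof (rule common_branch[of "y 0" "f ` G" S z])
    show "0 < y 0" "y 0 \<notin> \<rat>"
      by (rule real_orbitD[OF y])+
    show "finite (f ` G)" "f ` G \<noteq> {}"
      using G(2) False by simp_all
  qed (rule zS inequiv that; assumption)+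
  have "card G = card (f ` G)"
    using card_image[OF inj] by simp
  also have "\<dots> \<le> defect n A"
    by (rule card_le_defect[OF c(1) finite_imageI[OF G(2)] c(2-4)])
  finally show ?thesis .
qed simp

end

theorem theorem5p3:
  fixes n :: nat and A :: "nat \<Rightarrow> int^2^2" and a :: "nat \<Rightarrow> nat"
  assumes "slow_cf n A" and "a \<in> A_sharp n A"
  shows "partition_on (Sigma_equiv n A `` {a}) ((Sigma_equiv n A `` {a}) // tail_equiv n A) \<and>
         finite ((Sigma_equiv n A `` {a}) // tail_equiv n A) \<and>
         card ((Sigma_equiv n A `` {a}) // tail_equiv n A) \<le> defect n A"
proof -
  interpret slow_algorithm n A
    by unfold_locales (rule assms(1))
  show ?thesis
    using partition_tail_classes finite_if_finite_subsets_card_bdd card_tail_classes_le by metis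
qed

end
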